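(* In the bipartite agent–item setting described in the context, let $\mathcal{F}_{A,E}=(E,\mathcal{I}_A)$ be the combination of the systems $(E_{A,j},\mathcal{I}_{A,j})$, $j\in[M_A]$, where each $(E_{A,j},\mathcal{I}_{A,j})$ is a $k_j$-growth system, and let $\mathcal{F}_{B,E}=(E,\mathcal{I}_B)$ be the combination of the systems $(E_{B,j},\mathcal{I}_{B,j})$, $j\in[M_B]$, where each $(E_{B,j},\mathcal{I}_{B,j})$ is an $\ell_j$-growth system. Let $\mathcal{F}=(E,\mathcal{I})$ with $\mathcal{I}=\mathcal{I}_A\cap\mathcal{I}_B$, and $$\mathrm{Core}(X)=\bigcap_{j=1}^{M_A}\big((X\setminus E_{A,j})\cup\mathrm{PCore}_{j,A}(X\cap E_{A,j})\big)\cap\bigcap_{j=1}^{M_B}\big((X\setminus E_{B,j})\cup\mathrm{PCore}_{j,B}(X\cap E_{B,j})\big)$$ for $X\subseteq E$, where $\mathrm{PCore}_{j,A}$ and $\mathrm{PCore}_{j,B}$ are the primitive core functions of $(E_{A,j},\mathcal{I}_{A,j})$ and $(E_{B,j},\mathcal{I}_{B,j})$. Let $k=\max_{e\in E}\big(\sum_{j:\,e\in E_{A,j}}k_j+\sum_{j:\,e\in E_{B,j}}\ell_j\big)$, and let $Y=Y(p)\subseteq A$ be a random set containing each agent independently with probability $p\in[0,1]$. Then, for $p=\sqrt{1-\frac{1}{k+1}}$, $$\mathbb{E}\big[w(\mathrm{Core}(\mathrm{Rel}(Y)))\big]\ \ge\ \Big(2+\frac1k-2\sqrt{1+\frac1k}\Big)\,w(\mathrm{OPT}(E)),\qquad\text{where}\quad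 2+\frac1k-2\sqrt{1+\frac1k}\;>\;\frac{1}{4k^2}-\frac{1}{8k^3}.$$ Furthermore, if all components are matroids (i.e. $\mathcal{F}$ is a $k$-matchoid, with all $k_j=\ell_j=1$), setting $p=0$ for $k=1$ and $p=1-1/(2k)$ for $k\ge2$ yields $$\mathbb{E}\big[w(\mathrm{Core}(\mathrm{Rel}(Y)))\big]\ \ge\ \begin{cases} w(\mathrm{OPT}(E)) & \text{if }k=1,\\ \frac{1}{4k^2}\,w(\mathrm{OPT}(E)) & \text{if }k\ge2.\end{cases}$$
   Context: An independence system $(S,\mathcal{I})$ is a finite set $S$ with a nonempty downward-closed family $\mathcal{I}\subseteq 2^S$ of independent sets; circuits are minimal non-independent sets; a basis of $X\subseteq S$ is a maximal independent subset of $X$. The combination of $(S_j,\mathcal{I}_j)$, $j\in[M]$, is $(S,\mathcal{I})$ with $S=\bigcup_jS_j$, $\mathcal{I}=\{I\subseteq S: I\cap S_j\in\mathcal{I}_j\ \forall j\}$. $(S,\mathcal{I})$ is a $k$-growth system ($k$ a positive integer) if for all $X\subseteq S$, $I\in\mathcal{I}$ there is a partition $(Q,Z)$ of $I\setminus X$ with $|Z|\le k|X\setminus I|$ such that $P\cup Q\in\mathcal{I}$ for every basis $P$ of $X$. (The 1-growth systems are exactly matroids.) Write $X+e=X\cup\{e\}$, $w(X)=\sum_{x\in X}w(x)$. Setting: $G=(A\cup B,E)$ is a finite bipartite graph (agents $A$, items $B$), $w:E\to\mathbb{R}_{\ge0}$ is injective, and $\delta(v)$, $\delta(Y)$ denote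 the sets of edges incident to a vertex $v$, resp. to a vertex set $Y\subseteq A$. The agent-side constraint is a combination $\mathcal{F}_A$ on $A$ of systems $(A_j,\mathcal{J}_j)$, $j\in[M_A]$, and the item-side constraint is a combination $\mathcal{F}_B$ on $B$ of systems $(B_j,\mathcal{L}_j)$, $j\in[M_B]$ (so $A=\bigcup_jA_j$, $B=\bigcup_jB_j$). They are transferred to edges, treating all edges at the same agent (resp. item) as parallel copies: $E_{A,j}$ is the set of edges incident to $A_j$, and $\mathcal{I}_{A,j}$ consists of the sets $X\subseteq E_{A,j}$ such that each agent is incident to at most one edge of $X$ and the set of agents incident to $X$ belongs to $\mathcal{J}_j$; likewise $E_{B,j}$ is the set of edges incident to $B_j$, and $\mathcal{I}_{B,j}$ consists of the $X\subseteq E_{B,j}$ such that each item is incident to at most one edge of $X$ and the set of items incident to $X$ belongs to $\mathcal{L}_j$. $\mathrm{OPT}(E)$ is a maximum-weight set in $\mathcal{I}$. Primitive hull and core of an independence system $(S,\mathcal{I})$: $\mathrm{PHull}(X)=X\cup\{e\in S:e\text{ belongs to some circuit contained in }X+e\}$ and $\mathrm{PCore}(X)=\{e\in X:e\notin\mathrm{PHull}(\{f\in X:w(f)>w(e)\})\}$. $\mathrm{Greedy}(X)$ for $X\subseteq E$: process the edges of $X$ in decreasing order of $w$, starting from $\emptyset$, adding an edge whenever the current set stays in $\mathcal{I}$; $\mathrm{Greedy}(X)$ is the final set. An edge $e\notin X$ is greedy-relevant with respect to $X$ if $e\in\mathrm{Greedy}(X+e)$. For $Y\subseteq A$ and $a\in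 A\setminus Y$, the top-relevant edge of $a$ is the heaviest edge in $\delta(a)$ that is greedy-relevant with respect to $\delta(Y)$ (if any exists). $\mathrm{Rel}(Y)\subseteq E$ is the set of top-relevant edges of all agents $a\in A\setminus Y$ having one. *)

theory Defs
  imports "HOL-Probability.Product_PMF"
begin

section \<open>Independence systems\<close>

definition indep_system :: "'e set \<Rightarrow> 'e set set \<Rightarrow> bool" where
  "indep_system S \<I> \<longleftrightarrow>
     finite S \<and> \<I> \<subseteq> Pow S \<and> \<I> \<noteq> {} \<and> (\<forall>X\<in>\<I>. \<forall>Y\<subseteq>X. Y \<in> \<I>)"

definition circuit :: "'e set \<Rightarrow> 'e set set \<Rightarrow> 'e set \<Rightarrow> bool" where
  "circuit S \<I> C \<longleftrightarrow> C \<subseteq> S \<and> C \<notin> \<I> \<and> (\<forall>D. D \<subset> C \<longrightarrow> D \<in> \<I>)"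

definition basis_of :: "'e set set \<Rightarrow> 'e set \<Rightarrow> 'e set \<Rightarrow> bool" where
  "basis_of \<I> X P \<longleftrightarrow> P \<in> \<I> \<and> P \<subseteq> X \<and> (\<forall>P'\<in>\<I>. P \<subseteq> P' \<and> P' \<subseteq> X \<longrightarrow> P' = P)"

definition combination :: "nat set \<Rightarrow> (nat \<Rightarrow> 'e set) \<Rightarrow> (nat \<Rightarrow> 'e set set) \<Rightarrow> 'e set set" where
  "combination J S \<I> = {I. I \<subseteq> (\<Union>j\<in>J. S j) \<and> (\<forall>j\<in>J. I \<inter> S j \<in> \<I> j)}"

text \<open>The two parts \<open>Q\<close> and \<open>Z\<close> of the partition of \<open>I - X\<close> may be empty.\<close>

definition growth_system :: "nat \<Rightarrow> 'e set \<Rightarrow> 'e set set \<Rightarrow> bool" where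
  "growth_system k S \<I> \<longleftrightarrow> 0 < k \<and> indep_system S \<I> \<and>
     (\<forall>X I. X \<subseteq> S \<longrightarrow> I \<in> \<I> \<longrightarrow>
        (\<exists>Q Z. Q \<union> Z = I - X \<and> Q \<inter> Z = {} \<and> card Z \<le> k * card (X - I) \<and>
               (\<forall>P. basis_of \<I> X P \<longrightarrow> P \<union> Q \<in> \<I>)))"

definition matroid :: "'e set \<Rightarrow> 'e set set \<Rightarrow> bool" where
  "matroid S \<I> \<longleftrightarrow> indep_system S \<I> \<and>
     (\<forall>X\<in>\<I>. \<forall>Y\<in>\<I>. card X < card Y \<longrightarrow> (\<exists>e\<in>Y - X. insert e X \<in> \<I>))"

definition PHull :: "'e set \<Rightarrow> 'e set set \<Rightarrow> 'e set \<Rightarrow> 'e set" where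
  "PHull S \<I> X = X \<union> {e \<in> S. \<exists>C. circuit S \<I> C \<and> C \<subseteq> insert e X \<and> e \<in> C}"

definition PCore :: "('e \<Rightarrow> real) \<Rightarrow> 'e set \<Rightarrow> 'e set set \<Rightarrow> 'e set \<Rightarrow> 'e set" where
  "PCore w S \<I> X = {e \<in> X. e \<notin> PHull S \<I> {f \<in> X. w f > w e}}"

definition greedy :: "('e \<Rightarrow> real) \<Rightarrow> 'e set set \<Rightarrow> 'e set \<Rightarrow> 'e set" where
  "greedy w \<I> X = fold (\<lambda>e I. if insert e I \<in> \<I> then insert e I else I)
                       (sorted_key_list_of_set (\<lambda>e. - w e) X) {}"

definition greedy_relevant :: "('e \<Rightarrow> real) \<Rightarrow> 'e set set \<Rightarrow> 'e set \<Rightarrow> 'e \<Rightarrow> bool" where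
  "greedy_relevant w \<I> X e \<longleftrightarrow> e \<notin> X \<and> e \<in> greedy w \<I> (insert e X)"


section \<open>Bipartite graphs\<close>

text \<open>
  Agents and items have different types, so that the two sides of the bipartite graph are
  disjoint; edges are pairs. The constructions common to both sides are parametrised by the
  endpoint map \<open>v\<close>, which is \<open>fst\<close> for agents and \<open>snd\<close> for items.
\<close>

definition incident_edges :: "('e \<Rightarrow> 'v) \<Rightarrow> 'e set \<Rightarrow> 'v set \<Rightarrow> 'e set" where
  "incident_edges v E V = {e \<in> E. v e \<in> V}"

text \<open>Injectivity of \<open>v\<close> on \<open>X\<close> says that each vertex is incident to at most one edge of \<open>X\<close>.\<close>

definition edge_indep :: "('e \<Rightarrow> 'v) \<Rightarrow> 'e set \<Rightarrow> 'v set \<Rightarrow> 'v set set \<Rightarrow> 'e set set" where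
  "edge_indep v E V \<J> = {X. X \<subseteq> incident_edges v E V \<and> inj_on v X \<and> v ` X \<in> \<J>}"

definition top_relevant ::
  "('a \<times> 'b) set \<Rightarrow> ('a \<times> 'b \<Rightarrow> real) \<Rightarrow> ('a \<times> 'b) set set \<Rightarrow> 'a set \<Rightarrow> 'a \<Rightarrow> 'a \<times> 'b \<Rightarrow> bool" where
  "top_relevant E w \<I> Y a e \<longleftrightarrow>
     is_arg_max w (\<lambda>e. e \<in> incident_edges fst E {a} \<and>
                       greedy_relevant w \<I> (incident_edges fst E Y) e) e"

definition Rel ::
  "'a set \<Rightarrow> ('a \<times> 'b) set \<Rightarrow> ('a \<times> 'b \<Rightarrow> real) \<Rightarrow> ('a \<times> 'b) set set \<Rightarrow> 'a set \<Rightarrow> ('a \<times> 'b) set" where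
  "Rel A E w \<I> Y = {e. \<exists>a\<in>A - Y. top_relevant E w \<I> Y a e}"

definition random_subset :: "real \<Rightarrow> 'a set \<Rightarrow> 'a set pmf" where
  "random_subset p A = map_pmf (\<lambda>f. {a \<in> A. f a}) (Pi_pmf A False (\<lambda>_. bernoulli_pmf p))"

end

theory Submission
  imports Defs
begin

text \<open>
  Whether an edge is the first addable edge of its agent does not depend on whether that agent is
  sampled: sampled candidates form the greedy set \<open>S\<close> of the sample and the others form \<open>R = Rel Y\<close>,
  so \<open>p E[w(R)] = (1 - p) E[w(S)]\<close>, and \<open>k w(S)\<close> dominates the sampled part of the optimum.
  The same exchange applies to the candidates lying in the \<open>j\<close>-th primitive hull of the heavier part
  of \<open>R\<close>: those in \<open>R\<close> are lost by the core, and those in \<open>S\<close> weigh at most \<open>k\<^sub>j w(R \<inter> E\<^sub>j)\<close> by the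
  growth property. For a matroid they weigh at most as much as the primitive core of \<open>R \<inter> E\<^sub>j\<close>, a
  basis of that set, which gives the better constant. Every edge lies in an agent-side and
  in an item-side component, hence \<open>k \<ge> 2\<close> and the case \<open>k = 1\<close> is void.
\<close>

section \<open>Independence systems\<close>

lemma
  assumes "indep_system S \<I>"
  shows indep_system_finite: "X \<subseteq> S \<Longrightarrow> finite X"
    and indep_system_down: "X \<in> \<I> \<Longrightarrow> Y \<subseteq> X \<Longrightarrow> Y \<in> \<I>"
    and indep_system_empty: "{} \<in> \<I>"
  using assms finite_subset[of X S] unfolding indep_system_def by auto

lemma indep_system_dependent_circuit:
  assumes "indep_system S \<I>" "X \<subseteq> S" "X \<notin> \<I>"
  obtains C where "circuit S \<I> C" "C \<subseteq> X"
proof -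
  have "finite X" using indep_system_finite[OF assms(1,2)] .
  then obtain C where C: "C \<subseteq> X" "C \<notin> \<I>"
      and min: "\<forall>D\<in>{D. D \<subseteq> X \<and> D \<notin> \<I>}. D \<subseteq> C \<longrightarrow> C = D"
    using finite_has_minimal2[of "{D. D \<subseteq> X \<and> D \<notin> \<I>}" X] assms(3) by auto
  have "D \<in> \<I>" if "D \<subset> C" for D
    using min[rule_format, of D] that C(1) by auto
  then have "circuit S \<I> C"
    using assms(2) C unfolding circuit_def by simp
  with C(1) show ?thesis by (rule that[rotated])
qed

lemma indep_system_extend_basis:
  assumes "indep_system S \<I>" "X \<subseteq> S" "I \<in> \<I>" "I \<subseteq> X"
  obtains P where "basis_of \<I> X P" "I \<subseteq> P"
proof -
  have "finite X" using indep_system_finite[OF assms(1,2)] .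
  then obtain P where "P \<in> \<I>" "P \<subseteq> X" "I \<subseteq> P"
      and "\<forall>D\<in>{D. D \<subseteq> X \<and> D \<in> \<I>}. P \<subseteq> D \<longrightarrow> P = D"
    using finite_has_maximal2[of "{D. D \<subseteq> X \<and> D \<in> \<I>}" I] assms by auto
  then have "basis_of \<I> X P" "I \<subseteq> P"
    unfolding basis_of_def by auto
  then show ?thesis by (rule that)
qed

section \<open>Circuits, primitive hulls and bounds on what they span\<close>

lemma circuit_remove: "circuit S \<I> C \<Longrightarrow> x \<in> C \<Longrightarrow> C - {x} \<in> \<I>"
  unfolding circuit_def by (elim conjE allE[of _ "C - {x}"]) auto

lemma PHull_not_mem_iff:
  assumes "e \<notin> X"
  shows "e \<in> PHull S \<I> X \<longleftrightarrow> e \<in> S \<and> (\<exists>C. circuit S \<I> C \<and> C \<subseteq> insert e X \<and> e \<in> C)"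
  using assms unfolding PHull_def by auto

lemma PHull_mono: "X \<subseteq> Y \<Longrightarrow> PHull S \<I> X \<subseteq> PHull S \<I> Y"
  unfolding PHull_def by blast

text \<open>An element of \<open>Q\<close> would close a circuit with part of \<open>X\<close>.
  Since \<open>Q\<close> serves every basis of \<open>X\<close> at once, a basis containing that
  part may be chosen, and its union with \<open>Q\<close> would contain the circuit. Hence
  \<open>Q\<close> is empty and all of \<open>D\<close> is charged to \<open>Z\<close>.\<close>

lemma growth_system_card_PHull:
  assumes grow: "growth_system k S \<I>" and XS: "X \<subseteq> S" and "D \<in> \<I>"
    and "D \<inter> X = {}" and hull: "D \<subseteq> PHull S \<I> X"
  shows "card D \<le> k * card X"
proof -
  have sys: "indep_system S \<I>" using grow unfolding growth_system_def by blast
  obtain Q Z where QZ: "Q \<union> Z = D - X" "card Z \<le> k * card (X - D)"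
      "\<And>P. basis_of \<I> X P \<Longrightarrow> P \<union> Q \<in> \<I>"
    using grow XS \<open>D \<in> \<I>\<close> unfolding growth_system_def by metis
  have "Q = {}"
  proof (rule ccontr)
    assume "Q \<noteq> {}"
    then obtain s where s: "s \<in> Q" by auto
    then have "s \<in> PHull S \<I> X" "s \<notin> X" using QZ hull by auto
    then obtain C where C: "circuit S \<I> C" "C \<subseteq> insert s X" "s \<in> C"
      using PHull_not_mem_iff by metis
    have "C - {s} \<in> \<I>" "C - {s} \<subseteq> X" using circuit_remove[OF C(1,3)] C(2) by auto
    then obtain P where P: "basis_of \<I> X P" "C - {s} \<subseteq> P"
      using indep_system_extend_basis[OF sys XS] by metis
    have "C \<subseteq> P \<union> Q" using s P by auto
    then have "C \<in> \<I>" using indep_system_down[OF sys QZ(3)[OF P(1)]] by blast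
    then show False using C unfolding circuit_def by blast
  qed
  then have "D = Z" using QZ(1) \<open>D \<inter> X = {}\<close> by auto
  moreover have "X - D = X" using \<open>D \<inter> X = {}\<close> by auto
  ultimately show ?thesis using QZ(2) by simp
qed

text \<open>A basis \<open>P'\<close> of \<open>X\<close> that contains \<open>C - {x}\<close>
  certainly spans \<open>x\<close>. Augmentation gives \<open>card P' \<le> card P\<close>, so an
  independent \<open>insert x P\<close> would be larger than \<open>P'\<close> and extend it by
  \<open>x\<close> or by an element of \<open>X\<close>, both impossible.\<close>

lemma matroid_basis_spans:
  assumes mat: "matroid S \<I>" and XS: "X \<subseteq> S" and P: "basis_of \<I> X P"
    and C: "circuit S \<I> C" "C \<subseteq> insert x X" "x \<in> C" and "x \<notin> X"
  shows "insert x P \<notin> \<I>"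
proof
  assume indep: "insert x P \<in> \<I>"
  have sys: "indep_system S \<I>" using mat unfolding matroid_def by blast
  have "C - {x} \<in> \<I>" "C - {x} \<subseteq> X" using circuit_remove[OF C(1,3)] C(2) by auto
  then obtain P' where P': "basis_of \<I> X P'" "C - {x} \<subseteq> P'"
    using indep_system_extend_basis[OF sys XS] by metis
  have fin: "finite P" "finite P'"
    using P P' XS indep_system_finite[OF sys] unfolding basis_of_def by auto
  have dep: "insert x P' \<notin> \<I>"
  proof
    assume "insert x P' \<in> \<I>"
    moreover have "C \<subseteq> insert x P'" using P' by auto
    ultimately have "C \<in> \<I>" by (rule indep_system_down[OF sys])
    then show False using C unfolding circuit_def by blast
  qed
  have max: "insert e P' \<notin> \<I>" if "e \<in> X - P'" for e
    using P' that unfolding basis_of_def by auto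
  have "card P' \<le> card P"
  proof (rule ccontr)
    assume "\<not> card P' \<le> card P"
    then obtain e where "e \<in> P' - P" "insert e P \<in> \<I>"
      using mat P P' unfolding matroid_def basis_of_def by (metis not_le)
    moreover have "P \<subseteq> X" using P unfolding basis_of_def by simp
    moreover have "P' \<subseteq> X" using P' unfolding basis_of_def by simp
    ultimately have "e \<in> X" "e \<notin> P" "insert e P \<in> \<I>" "insert e P \<subseteq> X" by auto
    then have "insert e P = P" using P unfolding basis_of_def by blast
    then show False using \<open>e \<notin> P\<close> by auto
  qed
  then have "card P' < card (insert x P)"
    using P \<open>x \<notin> X\<close> fin unfolding basis_of_def by (subst card_insert_disjoint) auto
  then obtain e where "e \<in> insert x P - P'" "insert e P' \<in> \<I>"
    using mat P' indep unfolding matroid_def basis_of_def by meson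
  then show False
    using dep max P unfolding basis_of_def by blast
qed

text \<open>If \<open>D\<close> were larger, augmentation would add to \<open>P\<close> an element
  of \<open>X\<close>, against maximality, or one spanned by \<open>X\<close>, against
  \<open>matroid_basis_spans\<close>. The bound is by a basis, where a growth system only gives a
  multiple of \<open>card X\<close>.\<close>

lemma matroid_card_PHull:
  assumes mat: "matroid S \<I>" and XS: "X \<subseteq> S" and P: "basis_of \<I> X P"
    and "D \<in> \<I>" and "D \<subseteq> PHull S \<I> X"
  shows "card D \<le> card P"
proof (rule ccontr)
  assume "\<not> card D \<le> card P"
  then obtain e where e: "e \<in> D - P" "insert e P \<in> \<I>"
    using mat P \<open>D \<in> \<I>\<close> unfolding matroid_def basis_of_def by (metis not_le)
  have "e \<notin> X" using e P unfolding basis_of_def by blast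
  then obtain C where "circuit S \<I> C" "C \<subseteq> insert e X" "e \<in> C"
    using e assms(5) PHull_not_mem_iff by (metis DiffD1 subsetD)
  with matroid_basis_spans[OF mat XS P] \<open>e \<notin> X\<close> e(2) show False by blast
qed

section \<open>Primitive cores and their threshold levels\<close>

lemma PCore_subset: "PCore w S \<I> X \<subseteq> X"
  unfolding PCore_def by blast

text \<open>Survival of \<open>e\<close> depends only on elements heavier than \<open>e\<close>, and
  cutting at \<open>t \<le> w e\<close> removes none of those.\<close>

lemma PCore_above:
  "PCore w S \<I> {f \<in> X. t \<le> w f} = {f \<in> PCore w S \<I> X. t \<le> w f}"
proof -
  have "{f. (f \<in> X \<and> t \<le> w f) \<and> w f > w e} = {f. f \<in> X \<and> w f > w e}" if "t \<le> w e" for e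
    using that by auto
  then show ?thesis unfolding PCore_def by auto
qed

text \<open>The lightest element of a circuit lies in the primitive hull of the others, which are
  strictly heavier because weights are distinct; so the core contains no circuit.\<close>

lemma PCore_indep:
  assumes "indep_system S \<I>" "inj_on w S" "X \<subseteq> S"
  shows "PCore w S \<I> X \<in> \<I>"
proof (rule ccontr)
  assume "PCore w S \<I> X \<notin> \<I>"
  then obtain C where C: "circuit S \<I> C" "C \<subseteq> PCore w S \<I> X"
    using indep_system_dependent_circuit assms PCore_subset by (metis subset_trans)
  have sub: "C \<subseteq> X" using C(2) PCore_subset by (rule subset_trans)
  then have "finite C" using assms(3) by (intro indep_system_finite[OF assms(1)]) auto
  moreover have "C \<noteq> {}" using C indep_system_empty[OF assms(1)] unfolding circuit_def by auto
  ultimately obtain e where e: "e \<in> C" "\<And>f. f \<in> C \<Longrightarrow> w e \<le> w f"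
    by (meson arg_min_if_finite not_less)
  have "C \<subseteq> insert e {f \<in> X. w f > w e}"
  proof
    fix f assume f: "f \<in> C"
    then have "w f \<noteq> w e \<or> f = e"
      using e(1) sub assms(2,3) by (meson inj_onD subsetD)
    then show "f \<in> insert e {f \<in> X. w f > w e}"
      using e(2)[OF f] f sub by auto
  qed
  then have "e \<in> PHull S \<I> {f \<in> X. w f > w e}"
    using C e(1) sub assms(3) unfolding PHull_def by blast
  then show False using C e(1) unfolding PCore_def by blast
qed

lemma matroid_PCore_basis:
  assumes mat: "matroid S \<I>" and inj: "inj_on w S" and XS: "X \<subseteq> S"
  shows "basis_of \<I> X (PCore w S \<I> X)"
proof -
  have sys: "indep_system S \<I>" using mat unfolding matroid_def by blast
  have fin: "finite X" using sys XS by (rule indep_system_finite)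
  show ?thesis
    using fin XS
  \<comment> \<open>Elements arrive in order of decreasing weight, so the new \<open>x\<close> is
    the lightest and leaves the core status of the earlier ones unchanged.\<close>
  proof (induction rule: finite_ranking_induct[where f = "\<lambda>e. - w e"])
    case empty
    show ?case unfolding basis_of_def PCore_def using indep_system_empty[OF sys] by auto
  next
    case (insert x X)
    show ?case
    proof (cases "x \<in> X")
      case True
      then show ?thesis using insert by (simp add: insert_absorb)
    next
      case False
      let ?P = "PCore w S \<I> X" and ?P' = "PCore w S \<I> (insert x X)"
      have lt: "w x < w y" if "y \<in> X" for y
      proof -
        have "w x \<noteq> w y" using that False inj insert.prems by (metis inj_onD insert_subset subsetD)
        then show ?thesis using insert.hyps(2)[OF that] by auto
      qed
      have IH: "basis_of \<I> X ?P" using insert by auto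
      have above_x: "{f \<in> insert x X. w f > w x} = X" using lt by auto
      have above: "{f \<in> insert x X. w f > w y} = {f \<in> X. w f > w y}" if "y \<in> X" for y
        using lt[OF that] by auto
      have P': "?P' = ?P \<union> {e. e = x \<and> x \<notin> PHull S \<I> X}"
      proof (rule set_eqI)
        fix e
        show "e \<in> ?P' \<longleftrightarrow> e \<in> ?P \<union> {e. e = x \<and> x \<notin> PHull S \<I> X}"
        proof (cases "e \<in> X")
          case True
          then show ?thesis using above[OF True] False unfolding PCore_def by fastforce
        next
          case False
          then show ?thesis using above_x unfolding PCore_def by fastforce
        qed
      qed
      have indep: "?P' \<in> \<I>" by (rule PCore_indep[OF sys inj insert.prems])
      have "insert y ?P' \<notin> \<I>" if y: "y \<in> insert x X - ?P'" for y
      proof (cases "y = x")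
        case True
        then have "x \<in> PHull S \<I> X" "?P' = ?P" using y P' by auto
        then obtain C where "circuit S \<I> C" "C \<subseteq> insert x X" "x \<in> C"
          using PHull_not_mem_iff[OF False] by metis
        then show ?thesis
          using matroid_basis_spans[OF mat _ IH] False insert.prems \<open>?P' = ?P\<close> True by auto
      next
        case False
        then have "y \<in> X - ?P" using y P' by auto
        then have "insert y ?P \<notin> \<I>" using IH unfolding basis_of_def by auto
        moreover have "insert y ?P \<subseteq> insert y ?P'" using P' by auto
        ultimately show ?thesis using indep_system_down[OF sys] by metis
      qed
      moreover have "?P' \<subseteq> insert x X" by (rule PCore_subset)
      moreover have "D = ?P'"
        if D: "D \<in> \<I>" "?P' \<subseteq> D" "D \<subseteq> insert x X"
          and dep: "\<And>y. y \<in> insert x X - ?P' \<Longrightarrow> insert y ?P' \<notin> \<I>" for D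
      proof (rule ccontr)
        assume "D \<noteq> ?P'"
        then obtain y where "y \<in> D - ?P'" using D(2) by blast
        moreover from this have "insert y ?P' \<in> \<I>"
          using D by (intro indep_system_down[OF sys D(1)]) auto
        ultimately show False using dep D(3) by blast
      qed
      ultimately show ?thesis using indep unfolding basis_of_def by blast
    qed
  qed
qed

section \<open>Greedy sets\<close>

text \<open>A discrete layer-cake argument: nonnegative weights are nonnegative combinations of
  indicators of the levels \<open>t \<le> w e\<close>. The combinatorial bounds on cardinalities
  become bounds on weights through this lemma.\<close>

lemma sum_le_of_threshold_cards:
  fixes w :: "'e \<Rightarrow> real"
  assumes "finite D" "finite R" "inj_on w (D \<union> R)" "\<And>e. e \<in> D \<union> R \<Longrightarrow> 0 \<le> w e"
    and card: "\<And>t. real (card {e \<in> D. t \<le> w e}) \<le> c * real (card {e \<in> R. t \<le> w e})"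
  shows "sum w D \<le> c * sum w R"
proof -
  \<comment> \<open>The signed multiplicity; an element common to \<open>D\<close> and
    \<open>R\<close> receives both terms.\<close>
  define \<alpha> where "\<alpha> e = c * of_bool (e \<in> R) - of_bool (e \<in> D)" for e
  have sum_\<alpha>: "(\<Sum>e\<in>{e \<in> D \<union> R. P e}. \<alpha> e * g e) = c * sum g {e \<in> R. P e} - sum g {e \<in> D. P e}"
    for g :: "'e \<Rightarrow> real" and P
  proof -
    have "(\<Sum>e\<in>{e \<in> D \<union> R. P e}. of_bool (e \<in> Y) * g e) = sum g {e \<in> Y. P e}"
      if "Y \<subseteq> D \<union> R" for Y
    proof -
      show ?thesis
        by (rule sum.mono_neutral_cong_right) (use assms(1,2) that in auto)
    qed
    from this[of R] this[of D] show ?thesis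
      unfolding \<alpha>_def by (simp add: left_diff_distrib sum_subtractf sum_distrib_left[symmetric] mult.assoc)
  qed
  have thr: "0 \<le> (\<Sum>e\<in>{e \<in> D \<union> R. t \<le> w e}. \<alpha> e)" for t
    using card[of t] sum_\<alpha>[of "\<lambda>_. 1" "\<lambda>e. t \<le> w e"] by simp
  \<comment> \<open>Abel summation: the lightest element is removed and its weight becomes the new shift \<open>m\<close>.\<close>
  have main: "0 \<le> (\<Sum>e\<in>U. \<alpha> e * (w e - m))"
    if "finite U" "inj_on w U" "\<And>t. 0 \<le> (\<Sum>e\<in>{e \<in> U. t \<le> w e}. \<alpha> e)" "\<And>e. e \<in> U \<Longrightarrow> m \<le> w e" for U m
    using that
  proof (induction arbitrary: m rule: finite_ranking_induct[where f = "\<lambda>e. - w e"])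
    case (insert x U)
    show ?case
    proof (cases "x \<in> U")
      case True
      then show ?thesis using insert by (simp add: insert_absorb)
    next
      case False
      have lt: "w x < w y" if "y \<in> U" for y
      proof -
        have "w x \<noteq> w y" using that False insert.prems(1) by (metis inj_onD insertCI)
        then show ?thesis using insert.hyps(2)[OF that] by auto
      qed
      have "0 \<le> (\<Sum>e\<in>{e \<in> U. t \<le> w e}. \<alpha> e)" for t
      proof (cases "t \<le> w x")
        case False
        then have "{e \<in> U. t \<le> w e} = {e \<in> insert x U. t \<le> w e}" by auto
        then show ?thesis using insert.prems(2) by simp
      next
        case True
        show ?thesis
        proof (cases "U = {}")
          case False
          \<comment> \<open>For \<open>t \<le> w x\<close> the level of \<open>U\<close> is all of
            \<open>U\<close>, which is also the level of \<open>insert x U\<close> at the smallest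
            weight in \<open>U\<close>.\<close>
          then obtain y where "y \<in> U" "\<And>z. z \<in> U \<Longrightarrow> w y \<le> w z"
            using insert.hyps(1) by (meson arg_min_if_finite not_less)
          then have "{e \<in> U. t \<le> w e} = {e \<in> insert x U. w y \<le> w e}"
            using True lt by force
          then show ?thesis using insert.prems(2) by simp
        qed simp
      qed
      then have "0 \<le> (\<Sum>e\<in>U. \<alpha> e * (w e - w x))"
        using insert.IH[of "w x"] insert.prems(1) insert.hyps(2) by force
      moreover have "0 \<le> (w x - m) * (\<Sum>e\<in>insert x U. \<alpha> e)"
      proof (rule mult_nonneg_nonneg)
        have "{e \<in> insert x U. w x \<le> w e} = insert x U" using lt by force
        then show "0 \<le> (\<Sum>e\<in>insert x U. \<alpha> e)" using insert.prems(2)[of "w x"] by simp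
      qed (use insert.prems(3) in auto)
      moreover have "(\<Sum>e\<in>insert x U. \<alpha> e * (w e - m))
          = (\<Sum>e\<in>U. \<alpha> e * (w e - w x)) + (w x - m) * (\<Sum>e\<in>insert x U. \<alpha> e)"
        using False insert.hyps(1)
        by (simp add: algebra_simps sum.distrib sum_subtractf sum_distrib_left)
      ultimately show ?thesis by simp
    qed
  qed simp
  \<comment> \<open>Nonnegativity of the weights permits the initial shift 0.\<close>
  from main[of "D \<union> R" 0] thr assms(1-4) have "0 \<le> (\<Sum>e\<in>D \<union> R. \<alpha> e * w e)" by simp
  moreover have "{e \<in> D \<union> R. True} = D \<union> R" "{e \<in> D. True} = D" "{e \<in> R. True} = R" by auto
  ultimately show ?thesis using sum_\<alpha>[of w "\<lambda>_. True"] by (metis diff_ge_0_iff_ge)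
qed

section \<open>The greedy set and its stability\<close>

lemma fold_greedy_subset:
  "fold (\<lambda>e I. if insert e I \<in> \<I> then insert e I else I) xs {} \<subseteq> set xs"
  by (induction xs rule: rev_induct) auto

text \<open>When \<open>e\<close> is examined, the current set consists of the accepted elements
  heavier than \<open>e\<close>, and everything accepted later is lighter. The final set thus
  determines every decision without reference to intermediate states.\<close>

lemma fold_greedy_mem_iff:
  fixes w :: "'e \<Rightarrow> real"
  defines "F \<equiv> \<lambda>\<I> xs. fold (\<lambda>e I. if insert e I \<in> \<I> then insert e I else I) xs {}"
  assumes "sorted_wrt (\<lambda>x y. w x > w y) xs" "e \<in> set xs"
  shows "e \<in> F \<I> xs \<longleftrightarrow> insert e {f \<in> F \<I> xs. w f > w e} \<in> \<I>"
  using assms(2,3)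
proof (induction xs rule: rev_induct)
  case (snoc x xs)
  have sub: "F \<I> xs \<subseteq> set xs" unfolding F_def by (rule fold_greedy_subset)
  have step: "F \<I> (xs @ [x]) = (if insert x (F \<I> xs) \<in> \<I> then insert x (F \<I> xs) else F \<I> xs)"
    unfolding F_def by simp
  have lt: "\<And>y. y \<in> set xs \<Longrightarrow> w x < w y" using snoc.prems by (simp add: sorted_wrt_append)
  show ?case
  proof (cases "e = x")
    case True
    have "x \<notin> F \<I> xs" using sub lt by blast
    moreover have "{f \<in> F \<I> (xs @ [x]). w f > w e} = F \<I> xs"
      using sub lt True step by auto
    ultimately show ?thesis using True step by simp
  next
    case False
    then have e: "e \<in> set xs" using snoc.prems by auto
    have "{f \<in> F \<I> (xs @ [x]). w f > w e} = {f \<in> F \<I> xs. w f > w e}"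
      using lt[OF e] step by auto
    moreover have "e \<in> F \<I> (xs @ [x]) \<longleftrightarrow> e \<in> F \<I> xs" using False step by auto
    ultimately show ?thesis using snoc e by (simp add: sorted_wrt_append)
  qed
qed simp

text \<open>
  An interpretation of \<^locale>\<open>folding_insort_key\<close> speaks of the locale constant on the left, not of
  the overloaded class constant.
\<close>

lemma linorder_sorted_key_list_of_set:
  "linorder.sorted_key_list_of_set (\<le>) f = sorted_key_list_of_set (f :: 'e \<Rightarrow> 'k::linorder)"
proof -
  have "linorder.insort_key (\<le>) f x xs = insort_key f x xs" for x xs
    by (induction xs) (simp_all add: linorder.insort_key.simps[OF linorder_axioms])
  then have "linorder.insort_key (\<le>) f = insort_key f" by blast
  then show ?thesis
    by (simp add: sorted_key_list_of_set_def linorder.sorted_key_list_of_set_def[OF linorder_axioms])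
qed

locale weighted_independence =
  fixes E :: "'e set" and w :: "'e \<Rightarrow> real" and \<I> :: "'e set set"
  assumes finite_E: "finite E" and inj_w: "inj_on w E" and sub_E: "\<I> \<subseteq> Pow E"
    and empty_indep: "{} \<in> \<I>" and down_closed: "X \<in> \<I> \<Longrightarrow> Y \<subseteq> X \<Longrightarrow> Y \<in> \<I>"
begin

abbreviation above :: "'e set \<Rightarrow> real \<Rightarrow> 'e set" where
  "above X t \<equiv> {f \<in> X. w f > t}"

lemma sorted_list:
  assumes "X \<subseteq> E"
  shows "set (sorted_key_list_of_set (\<lambda>e. - w e) X) = X"
    "sorted_wrt (\<lambda>x y. w x > w y) (sorted_key_list_of_set (\<lambda>e. - w e) X)"
proof -
  interpret folding_insort_key "(\<le>)" "(<)" E "\<lambda>e. - w e"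
    by unfold_locales (use inj_w in \<open>auto simp: inj_on_def\<close>)
  have "finite X" using assms finite_E finite_subset by blast
  then show "set (sorted_key_list_of_set (\<lambda>e. - w e) X) = X"
    using set_sorted_key_list_of_set[OF assms] unfolding linorder_sorted_key_list_of_set by blast
  show "sorted_wrt (\<lambda>x y. w x > w y) (sorted_key_list_of_set (\<lambda>e. - w e) X)"
    using strict_sorted_key_list_of_set[OF assms]
    unfolding linorder_sorted_key_list_of_set by (simp add: sorted_wrt_map)
qed

lemma greedy_subset: "X \<subseteq> E \<Longrightarrow> greedy w \<I> X \<subseteq> X"
  using fold_greedy_subset[of \<I> "sorted_key_list_of_set (\<lambda>e. - w e) X"] sorted_list(1)[of X]
  unfolding greedy_def by simp

lemma greedy_indep: "greedy w \<I> X \<in> \<I>"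
proof -
  have "fold (\<lambda>e I. if insert e I \<in> \<I> then insert e I else I) xs {} \<in> \<I>" for xs
    by (induction xs rule: rev_induct) (auto simp: empty_indep)
  then show ?thesis unfolding greedy_def by blast
qed

lemma greedy_mem_iff:
  assumes "X \<subseteq> E" "e \<in> X"
  shows "e \<in> greedy w \<I> X \<longleftrightarrow> insert e (above (greedy w \<I> X) (w e)) \<in> \<I>"
  using fold_greedy_mem_iff[OF sorted_list(2)[OF assms(1)], of e \<I>] sorted_list(1)[OF assms(1)] assms(2)
  unfolding greedy_def by simp

text \<open>Decisions depend only on heavier accepted elements, so two runs can first separate only
  at an accepted element offered to just one of them. The hypothesis tests rejection against the run
  on \<open>X\<close> alone; the induction carries it over to \<open>X'\<close>.\<close>

lemma greedy_above_cong:
  assumes X: "X \<subseteq> E" "X' \<subseteq> E"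
    and diff: "\<And>e. e \<in> (X - X') \<union> (X' - X) \<Longrightarrow> w e > t \<Longrightarrow> insert e (above (greedy w \<I> X) (w e)) \<notin> \<I>"
  shows "above (greedy w \<I> X) t = above (greedy w \<I> X') t"
proof -
  have sub: "greedy w \<I> X \<subseteq> X" "greedy w \<I> X' \<subseteq> X'" using greedy_subset X by auto
  have iff: "e \<in> greedy w \<I> X \<longleftrightarrow> e \<in> greedy w \<I> X'" if "w e > t" "e \<in> E" for e
    using that
  \<comment> \<open>Induction on the number of heavier elements, that is, from the heaviest
    downwards.\<close>
  proof (induction "card {f \<in> E. w f > w e}" arbitrary: e rule: less_induct)
    case less
    have "f \<in> greedy w \<I> X \<longleftrightarrow> f \<in> greedy w \<I> X'" if "w f > w e" "f \<in> E" for f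
    proof -
      have "{g \<in> E. w g > w f} \<subset> {g \<in> E. w g > w e}" using that by auto
      then have "card {g \<in> E. w g > w f} < card {g \<in> E. w g > w e}"
        using finite_E by (auto intro: psubset_card_mono)
      then show ?thesis using less that by auto
    qed
    then have eq: "above (greedy w \<I> X) (w e) = above (greedy w \<I> X') (w e)"
      using sub X by blast
    then have "e \<in> greedy w \<I> X \<longleftrightarrow> e \<in> greedy w \<I> X'" if "e \<in> X" "e \<in> X'"
      using greedy_mem_iff[OF X(1) that(1)] greedy_mem_iff[OF X(2) that(2)] by simp
    moreover have "e \<notin> greedy w \<I> X" if "e \<in> X - X'"
      using greedy_mem_iff[OF X(1)] diff[of e] that less.prems by auto
    moreover have "e \<notin> greedy w \<I> X'" if "e \<in> X' - X"
      using greedy_mem_iff[OF X(2)] diff[of e] that less.prems eq by auto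
    ultimately show ?case using sub by blast
  qed
  then show ?thesis using sub X by blast
qed

text \<open>Offering \<open>e\<close> as well cannot influence decisions on heavier elements, so
  relevance can be tested against the greedy set of \<open>X\<close> itself.\<close>

lemma greedy_relevant_iff:
  assumes "X \<subseteq> E" "e \<in> E"
  shows "greedy_relevant w \<I> X e \<longleftrightarrow> e \<notin> X \<and> insert e (above (greedy w \<I> X) (w e)) \<in> \<I>"
proof -
  have "above (greedy w \<I> X) (w e) = above (greedy w \<I> (insert e X)) (w e)"
    by (rule greedy_above_cong) (use assms in auto)
  then show ?thesis
    unfolding greedy_relevant_def using greedy_mem_iff[of "insert e X" e] assms by auto
qed

end

section \<open>Sampling agents\<close>

lemma set_random_subset: "set_pmf (random_subset p A) \<subseteq> Pow A"
  unfolding random_subset_def by auto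

lemma integrable_random_subset:
  fixes F :: "'a set \<Rightarrow> real"
  assumes "finite A"
  shows "integrable (measure_pmf (random_subset p A)) F"
  using assms set_random_subset[of p A]
  by (intro integrable_measure_pmf_finite) (metis finite_Pow_iff finite_subset)

lemma random_subset_insert:
  assumes "finite A" "a \<notin> A"
  shows "random_subset p (insert a A) =
    bernoulli_pmf p \<bind> (\<lambda>b. map_pmf (\<lambda>Y. if b then insert a Y else Y) (random_subset p A))"
proof -
  have "{x \<in> insert a A. (f(a := b)) x} = (if b then insert a {x \<in> A. f x} else {x \<in> A. f x})"
    for f b using assms(2) by auto
  then show ?thesis
    unfolding random_subset_def Pi_pmf_insert'[OF assms]
    by (simp add: map_bind_pmf map_pmf_comp map_pmf_def[symmetric])
qed

lemma expectation_random_subset_insert: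
  fixes F :: "'a set \<Rightarrow> real"
  assumes "finite A" "a \<notin> A" "0 \<le> p" "p \<le> 1"
  shows "measure_pmf.expectation (random_subset p (insert a A)) F =
    p * measure_pmf.expectation (random_subset p A) (\<lambda>Y. F (insert a Y)) +
    (1 - p) * measure_pmf.expectation (random_subset p A) F"
proof -
  have fin: "finite (set_pmf (random_subset p A))"
    using set_random_subset assms(1) by (metis finite_Pow_iff finite_subset)
  have "measure_pmf.expectation (random_subset p (insert a A)) F =
      (\<Sum>b\<in>UNIV. pmf (bernoulli_pmf p) b *\<^sub>R
        measure_pmf.expectation (map_pmf (\<lambda>Y. if b then insert a Y else Y) (random_subset p A)) F)"
    unfolding random_subset_insert[OF assms(1,2)]
    by (rule pmf_expectation_bind) (use fin in auto)
  then show ?thesis using assms(3,4) by (simp add: UNIV_bool)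
qed

text \<open>As \<open>h\<close> does not depend on the coin of \<open>a\<close>, the two
  expectations are \<open>1 - p\<close> and \<open>p\<close> times the expectation of
  \<open>h\<close> over the other agents.\<close>

lemma expectation_sample_exchange:
  fixes h :: "'a set \<Rightarrow> real"
  assumes "finite A" "a \<in> A" "0 \<le> p" "p \<le> 1"
    and inv: "\<And>Y. a \<notin> Y \<Longrightarrow> h (insert a Y) = h Y"
  shows "p * measure_pmf.expectation (random_subset p A) (\<lambda>Y. if a \<in> Y then 0 else h Y) =
    (1 - p) * measure_pmf.expectation (random_subset p A) (\<lambda>Y. if a \<in> Y then h Y else 0)"
proof -
  define A' where "A' = A - {a}"
  have A: "A = insert a A'" "finite A'" "a \<notin> A'" using assms unfolding A'_def by auto
  have a: "a \<notin> Y" if "Y \<in> set_pmf (random_subset p A')" for Y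
    using that A(3) set_random_subset by blast
  have "measure_pmf.expectation (random_subset p A') (\<lambda>Y. if a \<in> Y then 0 else h Y) =
      measure_pmf.expectation (random_subset p A') h"
    "measure_pmf.expectation (random_subset p A') (\<lambda>Y. if a \<in> Y then h Y else 0) = 0"
    "measure_pmf.expectation (random_subset p A') (\<lambda>Y. h (insert a Y)) =
      measure_pmf.expectation (random_subset p A') h"
    using a inv
    by (auto intro!: integral_cong_AE simp: AE_measure_pmf_iff
             intro: integral_eq_zero_AE)
  then show ?thesis
    unfolding A(1) expectation_random_subset_insert[OF A(2,3) assms(3,4)] by simp
qed

lemma prob_random_subset:
  assumes "finite A" "a \<in> A" "0 \<le> p" "p \<le> 1"
  shows "measure_pmf.expectation (random_subset p A) (\<lambda>Y. of_bool (a \<in> Y)) = p"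
proof -
  let ?E = "measure_pmf.expectation (random_subset p A)"
  \<comment> \<open>With \<open>h\<close> constantly 1 the exchange reads
    \<open>p * (1 - x) = (1 - p) * x\<close> for the probability \<open>x\<close> that
    \<open>a\<close> is sampled, hence \<open>x = p\<close>.\<close>
  have "p * ?E (\<lambda>Y. if a \<in> Y then 0 else 1) = (1 - p) * ?E (\<lambda>Y. if a \<in> Y then 1 else 0)"
    by (rule expectation_sample_exchange) (use assms in auto)
  moreover have "?E (\<lambda>Y. 1 - (if a \<in> Y then 1 else 0 :: real)) = 1 - ?E (\<lambda>Y. if a \<in> Y then 1 else 0)"
    using integrable_random_subset[OF assms(1)] by (subst Bochner_Integration.integral_diff) auto
  moreover have "(\<lambda>Y. if a \<in> Y then 0 else 1 :: real) = (\<lambda>Y. 1 - (if a \<in> Y then 1 else 0))" by auto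
  ultimately show ?thesis by (simp only: of_bool_def) argo
qed

section \<open>Candidate edges and the effect of toggling one agent\<close>

locale agent_edges = weighted_independence E w \<I>
  for E :: "('a \<times> 'b) set" and w :: "'a \<times> 'b \<Rightarrow> real" and \<I> :: "('a \<times> 'b) set set" +
  fixes A :: "'a set"
  assumes finite_A: "finite A" and fst_E: "e \<in> E \<Longrightarrow> fst e \<in> A"
    and inj_fst: "X \<in> \<I> \<Longrightarrow> inj_on fst X"
begin

definition sample_greedy :: "'a set \<Rightarrow> ('a \<times> 'b) set" where
  "sample_greedy Y = greedy w \<I> (incident_edges fst E Y)"

text \<open>Greedy relevance without the demand that the agent be unsampled, so that the test makes
  sense for all agents.\<close>

definition addable :: "'a set \<Rightarrow> 'a \<times> 'b \<Rightarrow> bool" where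
  "addable Y e \<longleftrightarrow> insert e (above (sample_greedy Y) (w e)) \<in> \<I>"

text \<open>
  The heaviest addable edge of every agent, sampled or not. Whether an edge is a candidate does
  not depend on whether its own agent is sampled; sampled candidates form the greedy set and the
  other ones form \<^const>\<open>Rel\<close>.
\<close>

definition candidates :: "'a set \<Rightarrow> ('a \<times> 'b) set" where
  "candidates Y = {e \<in> E. addable Y e \<and> (\<forall>f\<in>E. fst f = fst e \<longrightarrow> w f > w e \<longrightarrow> \<not> addable Y f)}"

lemma incident_subset: "incident_edges v E Y \<subseteq> E"
  unfolding incident_edges_def by auto

lemma sample_greedy_subset: "sample_greedy Y \<subseteq> incident_edges fst E Y"
  unfolding sample_greedy_def by (rule greedy_subset[OF incident_subset])

lemma sample_greedy_indep: "sample_greedy Y \<in> \<I>"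
  unfolding sample_greedy_def by (rule greedy_indep)

lemma sample_greedy_iff: "e \<in> E \<Longrightarrow> fst e \<in> Y \<Longrightarrow> e \<in> sample_greedy Y \<longleftrightarrow> addable Y e"
  unfolding addable_def sample_greedy_def
  by (rule greedy_mem_iff[OF incident_subset]) (auto simp: incident_edges_def)

lemma candidates_subset: "candidates Y \<subseteq> E"
  unfolding candidates_def by auto

text \<open>Greedy accepts a sampled edge exactly if it is addable, and independence allows one edge
  per agent; so an accepted edge is the heaviest addable one of its agent.\<close>

lemma sample_greedy_eq: "sample_greedy Y = {e \<in> candidates Y. fst e \<in> Y}"
proof (intro set_eqI iffI)
  fix e assume e: "e \<in> sample_greedy Y"
  then have E: "e \<in> E" "fst e \<in> Y" using sample_greedy_subset unfolding incident_edges_def by auto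
  have "\<not> addable Y f" if "f \<in> E" "fst f = fst e" "w f > w e" for f
  proof
    assume "addable Y f"
    then have "f \<in> sample_greedy Y" using sample_greedy_iff that E by auto
    then have "f = e" using inj_fst[OF sample_greedy_indep] e that(2) by (meson inj_onD)
    then show False using that by auto
  qed
  then show "e \<in> {e \<in> candidates Y. fst e \<in> Y}"
    using E e sample_greedy_iff unfolding candidates_def by auto
next
  fix e assume "e \<in> {e \<in> candidates Y. fst e \<in> Y}"
  then show "e \<in> sample_greedy Y" using sample_greedy_iff unfolding candidates_def by auto
qed

lemma Rel_eq: "Rel A E w \<I> Y = {e \<in> candidates Y. fst e \<notin> Y}"
proof -
  have rel: "greedy_relevant w \<I> (incident_edges fst E Y) e \<longleftrightarrow> fst e \<notin> Y \<and> addable Y e" if "e \<in> E" for e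
    using greedy_relevant_iff[OF incident_subset that, of fst Y] that
    unfolding addable_def sample_greedy_def by (simp add: incident_edges_def)
  have "e \<in> Rel A E w \<I> Y \<longleftrightarrow> fst e \<in> A - Y \<and> top_relevant E w \<I> Y (fst e) e" for e
    unfolding Rel_def top_relevant_def is_arg_max_def incident_edges_def by auto
  moreover have "top_relevant E w \<I> Y (fst e) e \<longleftrightarrow> e \<in> candidates Y" if "fst e \<notin> Y" for e
  proof -
    have "e \<in> E \<and> greedy_relevant w \<I> (incident_edges fst E Y) e \<longleftrightarrow> e \<in> E \<and> addable Y e"
      using rel[of e] that by auto
    moreover have "(f \<in> E \<and> fst f = fst e) \<and> greedy_relevant w \<I> (incident_edges fst E Y) f
        \<longleftrightarrow> (f \<in> E \<and> fst f = fst e) \<and> addable Y f" for f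
      using rel[of f] that by auto
    ultimately show ?thesis
      unfolding top_relevant_def is_arg_max_def candidates_def
      by (auto simp: incident_edges_def[of fst E "{fst e}"])
  qed
  ultimately show ?thesis using fst_E candidates_subset by blast
qed

text \<open>Toggling \<open>a\<close> changes only which edges of \<open>a\<close> are offered, and
  those above \<open>t\<close> would all be rejected. Comparing \<open>Y - {a}\<close> with
  \<open>Y' - {a}\<close> covers insertion and removal at once.\<close>

lemma sample_greedy_above_toggle:
  assumes "Y - {a} = Y' - {a}"
    and "\<And>f. f \<in> E \<Longrightarrow> fst f = a \<Longrightarrow> w f > t \<Longrightarrow> \<not> addable Y f"
  shows "above (sample_greedy Y) t = above (sample_greedy Y') t"
  unfolding sample_greedy_def
proof (rule greedy_above_cong[OF incident_subset incident_subset])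
  fix e assume e: "e \<in> (incident_edges fst E Y - incident_edges fst E Y') \<union>
      (incident_edges fst E Y' - incident_edges fst E Y)" "w e > t"
  then have "e \<in> E" "fst e = a" using assms(1) unfolding incident_edges_def by auto
  then show "insert e (above (greedy w \<I> (incident_edges fst E Y)) (w e)) \<notin> \<I>"
    using assms(2) e(2) unfolding addable_def sample_greedy_def by blast
qed

text \<open>No edge heavier than the candidate \<open>e\<close> is addable at its agent, so toggling
  that agent preserves the greedy set above \<open>w e\<close>. This settles addability for edges of
  every agent down to weight \<open>w e\<close>.\<close>

lemma candidate_addable_toggle:
  assumes "Y - {fst e} = Y' - {fst e}" "e \<in> candidates Y" "w f \<ge> w e"
  shows "addable Y f \<longleftrightarrow> addable Y' f"
proof -
  have "above (sample_greedy Y) (w f) = above (sample_greedy Y') (w f)"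
    by (rule sample_greedy_above_toggle[OF assms(1)])
      (use assms(2,3) in \<open>auto simp: candidates_def\<close>)
  then show ?thesis unfolding addable_def by simp
qed

lemma candidates_toggle:
  assumes "Y - {fst e} = Y' - {fst e}" "e \<in> candidates Y"
  shows "e \<in> candidates Y'"
  using candidate_addable_toggle[OF assms] assms(2) unfolding candidates_def by auto

text \<open>Heavier edges at the agent of \<open>e\<close> are candidates for neither sample; at
  other agents neither sampling nor, above \<open>w e\<close>, candidacy changes.\<close>

lemma Rel_above_toggle:
  assumes Y: "Y - {fst e} = Y' - {fst e}" and e: "e \<in> candidates Y"
  shows "above (Rel A E w \<I> Y) (w e) = above (Rel A E w \<I> Y') (w e)"
proof (rule set_eqI)
  fix f
  have e': "e \<in> candidates Y'" by (rule candidates_toggle[OF Y e])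
  show "f \<in> above (Rel A E w \<I> Y) (w e) \<longleftrightarrow> f \<in> above (Rel A E w \<I> Y') (w e)"
  proof (cases "f \<in> E \<and> w f > w e")
    case True
    show ?thesis
    proof (cases "fst f = fst e")
      case True
      then have "f \<notin> candidates Y" "f \<notin> candidates Y'" if "w f > w e"
        using e e' that unfolding candidates_def by auto
      then show ?thesis unfolding Rel_eq by auto
    next
      case False
      then have "fst f \<in> Y \<longleftrightarrow> fst f \<in> Y'" using Y by blast
      moreover have "f \<in> candidates Y \<longleftrightarrow> f \<in> candidates Y'"
        using True candidate_addable_toggle[OF Y e] unfolding candidates_def by auto
      ultimately show ?thesis unfolding Rel_eq by auto
    qed
  next
    case False
    then show ?thesis unfolding Rel_eq using candidates_subset by auto
  qed
qed

text \<open>Linearity over edges: whether \<open>e\<close> lies in \<open>H Y\<close> is independent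
  of the coin of its own agent, so the one-agent exchange applies to each edge.\<close>

lemma expectation_edge_exchange:
  assumes p: "0 \<le> p" "p \<le> 1" and H: "\<And>Y. H Y \<subseteq> E"
    and inv: "\<And>Y Y' e. Y - {fst e} = Y' - {fst e} \<Longrightarrow> e \<in> H Y \<Longrightarrow> e \<in> H Y'"
  shows "p * measure_pmf.expectation (random_subset p A) (\<lambda>Y. sum w {e \<in> H Y. fst e \<notin> Y}) =
    (1 - p) * measure_pmf.expectation (random_subset p A) (\<lambda>Y. sum w {e \<in> H Y. fst e \<in> Y})"
proof -
  let ?E = "measure_pmf.expectation (random_subset p A)"
  define h where "h e Y = (if e \<in> H Y then w e else 0)" for e Y
  have eq: "sum w {e \<in> H Y. fst e \<notin> Y} = (\<Sum>e\<in>E. if fst e \<in> Y then 0 else h e Y)"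
     "sum w {e \<in> H Y. fst e \<in> Y} = (\<Sum>e\<in>E. if fst e \<in> Y then h e Y else 0)" for Y
    unfolding h_def using H[of Y] finite_E
    by (auto intro!: sum.mono_neutral_cong_left split: if_splits)
  have "p * ?E (\<lambda>Y. if fst e \<in> Y then 0 else h e Y) = (1 - p) * ?E (\<lambda>Y. if fst e \<in> Y then h e Y else 0)"
    if "e \<in> E" for e
  proof (rule expectation_sample_exchange[OF finite_A fst_E[OF that] p])
    show "h e (insert (fst e) Y) = h e Y" for Y
      using inv[of Y e "insert (fst e) Y"] inv[of "insert (fst e) Y" e Y] unfolding h_def by auto
  qed
  then show ?thesis
    unfolding eq using integrable_random_subset[OF finite_A]
    by (simp add: Bochner_Integration.integral_sum sum_distrib_left)
qed

end

section \<open>Combinations of growth systems\<close>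

lemma sum_le_cover:
  fixes f :: "'e \<Rightarrow> real"
  assumes "finite U" "finite J" "\<And>e. e \<in> U \<Longrightarrow> 0 \<le> f e"
    and "C \<subseteq> U" "\<And>j. j \<in> J \<Longrightarrow> B j \<subseteq> U" "X \<subseteq> C \<union> (\<Union>j\<in>J. B j)"
  shows "sum f X \<le> sum f C + (\<Sum>j\<in>J. sum f (B j))"
  using assms(2,4-6)
proof (induction J arbitrary: C rule: finite_induct)
  case empty
  then show ?case using assms(1,3) finite_subset by (auto intro!: sum_mono2)
next
  case (insert x J)
  have fin: "finite C" "finite (B x)" using insert.prems finite_subset[OF _ assms(1)] by auto
  \<comment> \<open>The set \<open>B x\<close> is absorbed into \<open>C\<close>, which is why the
    induction varies \<open>C\<close>.\<close>
  have "sum f X \<le> sum f (C \<union> B x) + (\<Sum>j\<in>J. sum f (B j))"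
    using insert.prems by (intro insert.IH) auto
  moreover have "0 \<le> sum f (C \<inter> B x)"
    using insert.prems assms(3) by (intro sum_nonneg) auto
  then have "sum f (C \<union> B x) \<le> sum f C + sum f (B x)"
    using sum.union_inter[OF fin, of f] by simp
  ultimately show ?case using insert.hyps by simp
qed

text \<open>One index set carries agent-side and item-side components together, and \<open>k\<close>
  is any upper bound on the total growth at an edge.\<close>

locale growth_combination = agent_edges E w \<I> A
  for E :: "('a \<times> 'b) set" and w :: "'a \<times> 'b \<Rightarrow> real" and \<I> :: "('a \<times> 'b) set set" and A :: "'a set" +
  fixes J :: "'i set" and ES :: "'i \<Rightarrow> ('a \<times> 'b) set" and IS :: "'i \<Rightarrow> ('a \<times> 'b) set set"
    and g :: "'i \<Rightarrow> nat" and k :: nat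
  assumes nonneg: "e \<in> E \<Longrightarrow> 0 \<le> w e"
    and finite_J: "finite J" and J_nonempty: "J \<noteq> {}"
    and growth: "j \<in> J \<Longrightarrow> growth_system (g j) (ES j) (IS j)"
    and ES_subset: "j \<in> J \<Longrightarrow> ES j \<subseteq> E"
    and indep_iff: "X \<in> \<I> \<longleftrightarrow> X \<subseteq> E \<and> (\<forall>j\<in>J. X \<inter> ES j \<in> IS j)"
    and growth_bound: "e \<in> E \<Longrightarrow> (\<Sum>j | j \<in> J \<and> e \<in> ES j. g j) \<le> k"
    and k_pos: "1 \<le> k"
begin

definition core :: "('a \<times> 'b) set \<Rightarrow> ('a \<times> 'b) set" where
  "core X = (\<Inter>j\<in>J. (X - ES j) \<union> PCore w (ES j) (IS j) (X \<inter> ES j))"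

abbreviation rel :: "'a set \<Rightarrow> ('a \<times> 'b) set" where
  "rel \<equiv> Rel A E w \<I>"

text \<open>The hull is taken over \<open>rel Y\<close> for sampled candidates too, so that the test
  ignores the coin of the edge's own agent.\<close>

definition bad :: "'i \<Rightarrow> 'a set \<Rightarrow> ('a \<times> 'b) set" where
  "bad j Y = {e \<in> candidates Y \<inter> ES j. e \<in> PHull (ES j) (IS j) (above (rel Y) (w e) \<inter> ES j)}"

lemma finite_subset_E: "X \<subseteq> E \<Longrightarrow> finite X"
  using finite_E finite_subset by blast

lemma rel_subset: "rel Y \<subseteq> E"
  unfolding Rel_eq using candidates_subset by blast

text \<open>Double counting: after swapping the sums, each edge carries its total growth, which is
  at most \<open>k\<close>.\<close>

lemma sum_components_le:
  fixes f :: "'a \<times> 'b \<Rightarrow> real"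
  assumes "X \<subseteq> E" "\<And>e. e \<in> X \<Longrightarrow> 0 \<le> f e"
  shows "(\<Sum>j\<in>J. real (g j) * sum f (X \<inter> ES j)) \<le> real k * sum f X"
proof -
  have fin: "finite X" using assms(1) by (rule finite_subset_E)
  have "(\<Sum>j\<in>J. real (g j) * sum f (X \<inter> ES j)) =
      (\<Sum>j\<in>J. \<Sum>e\<in>X. if e \<in> ES j then real (g j) * f e else 0)"
    using fin by (simp add: sum_distrib_left sum.inter_restrict if_distrib cong: if_cong)
  also have "\<dots> = (\<Sum>e\<in>X. \<Sum>j\<in>J. if e \<in> ES j then real (g j) * f e else 0)"
    by (rule sum.swap)
  also have "\<dots> = (\<Sum>e\<in>X. real (\<Sum>j | j \<in> J \<and> e \<in> ES j. g j) * f e)"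
  proof (rule sum.cong[OF refl])
    fix e
    have "(\<Sum>j | j \<in> J \<and> e \<in> ES j. real (g j) * f e) = (\<Sum>j\<in>J. if e \<in> ES j then real (g j) * f e else 0)"
      using finite_J by (rule sum.inter_filter)
    then show "(\<Sum>j\<in>J. if e \<in> ES j then real (g j) * f e else 0) =
        real (\<Sum>j | j \<in> J \<and> e \<in> ES j. g j) * f e"
      by (simp add: sum_distrib_right)
  qed
  also have "\<dots> \<le> (\<Sum>e\<in>X. real k * f e)"
    using assms growth_bound by (intro sum_mono mult_right_mono) (auto simp only: of_nat_le_iff)
  finally show ?thesis by (simp add: sum_distrib_left)
qed

lemma component_system: "j \<in> J \<Longrightarrow> indep_system (ES j) (IS j)"
  using growth unfolding growth_system_def by blast

text \<open>In component \<open>j\<close> the growth property leaves an exceptional set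
  \<open>Z j\<close> outside of which elements of \<open>O'\<close> can be added to
  \<open>S\<close>. By maximality each element of \<open>O' - S\<close> is exceptional in some
  component, and the sizes of the \<open>Z j\<close> add up to at most
  \<open>k * card (S - O')\<close>.\<close>

lemma card_le_greedy:
  assumes SI: "S \<in> \<I>" and OI: "O' \<in> \<I>"
    and maximal: "\<And>e. e \<in> O' - S \<Longrightarrow> insert e S \<notin> \<I>"
  shows "card O' \<le> k * card S"
proof -
  have sub: "S \<subseteq> E" "O' \<subseteq> E" using SI OI indep_iff by auto
  note fin = sub[THEN finite_subset_E]
  have "\<exists>Z. Z \<subseteq> O' \<and> card Z \<le> g j * card ((S - O') \<inter> ES j) \<and>
      (\<forall>e\<in>(O' - S) \<inter> ES j. e \<notin> Z \<longrightarrow> insert e S \<inter> ES j \<in> IS j)" if j: "j \<in> J" for j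
  proof -
    have "S \<inter> ES j \<in> IS j" "O' \<inter> ES j \<in> IS j" "S \<inter> ES j \<subseteq> ES j" using SI OI indep_iff j by auto
    then obtain Q Z where QZ: "Q \<union> Z = O' \<inter> ES j - S \<inter> ES j"
        "card Z \<le> g j * card (S \<inter> ES j - O' \<inter> ES j)"
        "\<And>P. basis_of (IS j) (S \<inter> ES j) P \<Longrightarrow> P \<union> Q \<in> IS j"
      using growth[OF j] unfolding growth_system_def by metis
    \<comment> \<open>An independent set is a basis of itself, so the growth property speaks about
      adding \<open>Q\<close> to it.\<close>
    have "basis_of (IS j) (S \<inter> ES j) (S \<inter> ES j)"
      using \<open>S \<inter> ES j \<in> IS j\<close> unfolding basis_of_def by auto
    then have SQ: "(S \<inter> ES j) \<union> Q \<in> IS j" by (rule QZ(3))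
    have "insert e S \<inter> ES j \<in> IS j" if "e \<in> (O' - S) \<inter> ES j" "e \<notin> Z" for e
    proof (rule indep_system_down[OF component_system[OF j] SQ])
      have "e \<in> Q" using that QZ(1) by blast
      then show "insert e S \<inter> ES j \<subseteq> S \<inter> ES j \<union> Q" by auto
    qed
    moreover have "S \<inter> ES j - O' \<inter> ES j = (S - O') \<inter> ES j" by auto
    ultimately show ?thesis using QZ(1,2) by (intro exI[of _ Z]) auto
  qed
  then obtain Z where Z: "\<And>j. j \<in> J \<Longrightarrow> Z j \<subseteq> O'"
      "\<And>j. j \<in> J \<Longrightarrow> card (Z j) \<le> g j * card ((S - O') \<inter> ES j)"
      "\<And>j e. j \<in> J \<Longrightarrow> e \<in> (O' - S) \<inter> ES j \<Longrightarrow> e \<notin> Z j \<Longrightarrow> insert e S \<inter> ES j \<in> IS j"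
    by metis
  have "O' - S \<subseteq> (\<Union>j\<in>J. Z j)"
  proof
    fix e assume e: "e \<in> O' - S"
    then have "insert e S \<subseteq> E" using sub by auto
    then obtain j where j: "j \<in> J" "insert e S \<inter> ES j \<notin> IS j"
      using maximal[OF e] indep_iff by auto
    \<comment> \<open>A component without \<open>e\<close> sees no change when \<open>e\<close> is
      added.\<close>
    have "e \<in> ES j"
    proof (rule ccontr)
      assume "e \<notin> ES j"
      then have "insert e S \<inter> ES j = S \<inter> ES j" by auto
      then show False using j SI indep_iff by auto
    qed
    then show "e \<in> (\<Union>j\<in>J. Z j)" using Z(3)[OF j(1), of e] j e by auto
  qed
  then have "card (O' - S) \<le> card (\<Union>j\<in>J. Z j)"
    using finite_J Z(1) fin by (intro card_mono finite_UN_I) (auto intro: finite_subset)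
  also have "\<dots> \<le> (\<Sum>j\<in>J. card (Z j))" by (rule card_UN_le[OF finite_J])
  also have "\<dots> \<le> (\<Sum>j\<in>J. g j * card ((S - O') \<inter> ES j))" by (intro sum_mono Z(2))
  also have "\<dots> \<le> k * card (S - O')"
  proof -
    have "(\<Sum>j\<in>J. real (g j) * (\<Sum>e\<in>(S - O') \<inter> ES j. 1)) \<le> real k * (\<Sum>e\<in>S - O'. 1)"
      using sub by (intro sum_components_le) auto
    then have "real (\<Sum>j\<in>J. g j * card ((S - O') \<inter> ES j)) \<le> real (k * card (S - O'))" by simp
    then show ?thesis by (simp only: of_nat_le_iff)
  qed
  finally have "card (O' - S) \<le> k * card (S - O')" .
  moreover have "card (O' \<inter> S) \<le> k * card (S \<inter> O')" using k_pos by (simp add: Int_commute)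
  moreover have "card O' = card (O' - S) + card (O' \<inter> S)" "card S = card (S - O') + card (S \<inter> O')"
    using fin by (simp_all add: card_Diff_subset_Int card_mono)
  ultimately show ?thesis by (simp add: algebra_simps)
qed

text \<open>A rejected sampled edge of weight at least \<open>t\<close> conflicts with heavier
  accepted edges, all in the same level. Each greedy level is thus maximal against the matching
  level of \<open>O'\<close>, and \<open>card_le_greedy\<close> applies threshold by
  threshold.\<close>

lemma greedy_approximation:
  assumes OI: "O' \<in> \<I>"
  shows "sum w {e \<in> O'. fst e \<in> Y} \<le> real k * sum w (sample_greedy Y)"
proof -
  have sub: "O' \<subseteq> E" "sample_greedy Y \<subseteq> E"
    using OI sample_greedy_indep indep_iff by auto
  show ?thesis
  proof (rule sum_le_of_threshold_cards)
    show "finite {e \<in> O'. fst e \<in> Y}" "finite (sample_greedy Y)"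
      using sub finite_subset_E by auto
    show "inj_on w ({e \<in> O'. fst e \<in> Y} \<union> sample_greedy Y)"
      using sub by (intro inj_on_subset[OF inj_w]) auto
    show "0 \<le> w e" if "e \<in> {e \<in> O'. fst e \<in> Y} \<union> sample_greedy Y" for e
      using that sub nonneg[of e] by auto
    fix t
    have "card {e \<in> {e \<in> O'. fst e \<in> Y}. t \<le> w e} \<le> k * card {e \<in> sample_greedy Y. t \<le> w e}"
    proof (rule card_le_greedy)
      show "{e \<in> sample_greedy Y. t \<le> w e} \<in> \<I>" "{e \<in> {e \<in> O'. fst e \<in> Y}. t \<le> w e} \<in> \<I>"
        by (rule down_closed[OF sample_greedy_indep] down_closed[OF OI]; auto)+
      fix e assume e: "e \<in> {e \<in> {e \<in> O'. fst e \<in> Y}. t \<le> w e} - {e \<in> sample_greedy Y. t \<le> w e}"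
      then have "\<not> addable Y e" using sample_greedy_iff[of e Y] sub by auto
      moreover have "insert e (above (sample_greedy Y) (w e)) \<subseteq> insert e {e \<in> sample_greedy Y. t \<le> w e}"
        using e by auto
      ultimately show "insert e {e \<in> sample_greedy Y. t \<le> w e} \<notin> \<I>"
        unfolding addable_def using down_closed by blast
    qed
    then show "real (card {e \<in> {e \<in> O'. fst e \<in> Y}. t \<le> w e}) \<le>
        real k * real (card {e \<in> sample_greedy Y. t \<le> w e})"
      by (simp only: of_nat_mult[symmetric] of_nat_le_iff)
  qed
qed

section \<open>Bad edges: the loss of the core and its sampled counterpart\<close>

lemma bad_subset: "bad j Y \<subseteq> E"
  unfolding bad_def using candidates_subset by blast

lemma bad_toggle:
  assumes "Y - {fst e} = Y' - {fst e}" "e \<in> bad j Y"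
  shows "e \<in> bad j Y'"
  using assms candidates_toggle[OF assms(1)] Rel_above_toggle[OF assms(1)] unfolding bad_def by auto

lemma bad_rel: "{e \<in> bad j Y. fst e \<notin> Y} = rel Y \<inter> ES j - PCore w (ES j) (IS j) (rel Y \<inter> ES j)"
proof -
  have eq: "{f \<in> rel Y \<inter> ES j. w f > w e} = above (rel Y) (w e) \<inter> ES j" for e by auto
  show ?thesis unfolding PCore_def eq bad_def using Rel_eq[of Y] by auto
qed

text \<open>Prepares the hull bounds for every level: \<open>D Y t\<close> inherits independence
  from the greedy set, its edges are sampled while those of \<open>X Y t\<close> are not, and hulls
  are monotone.\<close>

lemma bad_sampled_threshold:
  assumes j: "j \<in> J"
  defines "D \<equiv> \<lambda>Y t. {e \<in> {e \<in> bad j Y. fst e \<in> Y}. t \<le> w e}"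
    and "X \<equiv> \<lambda>Y t. {e \<in> rel Y \<inter> ES j. t \<le> w e}"
  shows "D Y t \<in> IS j" "D Y t \<inter> X Y t = {}" "D Y t \<subseteq> PHull (ES j) (IS j) (X Y t)" "X Y t \<subseteq> ES j"
proof -
  have "sample_greedy Y \<inter> ES j \<in> IS j" using sample_greedy_indep indep_iff j by auto
  moreover have "D Y t \<subseteq> sample_greedy Y \<inter> ES j"
    unfolding D_def bad_def sample_greedy_eq by auto
  ultimately show "D Y t \<in> IS j" by (rule indep_system_down[OF component_system[OF j]])
  show "D Y t \<inter> X Y t = {}" unfolding D_def X_def Rel_eq by auto
  show "D Y t \<subseteq> PHull (ES j) (IS j) (X Y t)"
  proof
    fix e assume e: "e \<in> D Y t"
    then have "above (rel Y) (w e) \<inter> ES j \<subseteq> X Y t" unfolding D_def X_def by auto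
    then show "e \<in> PHull (ES j) (IS j) (X Y t)"
      using e PHull_mono unfolding D_def bad_def by blast
  qed
  show "X Y t \<subseteq> ES j" unfolding X_def by auto
qed

lemma bad_sampled_le:
  assumes j: "j \<in> J"
  shows "sum w {e \<in> bad j Y. fst e \<in> Y} \<le> real (g j) * sum w (rel Y \<inter> ES j)"
proof (rule sum_le_of_threshold_cards)
  have sub: "{e \<in> bad j Y. fst e \<in> Y} \<subseteq> E" "rel Y \<inter> ES j \<subseteq> E"
    using bad_subset rel_subset by blast+
  then show "finite {e \<in> bad j Y. fst e \<in> Y}" "finite (rel Y \<inter> ES j)"
    using finite_subset_E by blast+
  show "inj_on w ({e \<in> bad j Y. fst e \<in> Y} \<union> rel Y \<inter> ES j)"
    by (rule inj_on_subset[OF inj_w]) (rule Un_least[OF sub])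
  show "0 \<le> w e" if "e \<in> {e \<in> bad j Y. fst e \<in> Y} \<union> rel Y \<inter> ES j" for e
    using that sub nonneg[of e] by blast
  show "real (card {e \<in> {e \<in> bad j Y. fst e \<in> Y}. t \<le> w e}) \<le>
      real (g j) * real (card {e \<in> rel Y \<inter> ES j. t \<le> w e})" for t
    using growth_system_card_PHull[OF growth[OF j] bad_sampled_threshold(4,1,2,3)[OF j]]
    by (simp only: of_nat_mult[symmetric] of_nat_le_iff)
qed

text \<open>Each level of the primitive core is a basis of that level of \<open>rel Y\<close>, so
  the sampled bad edges are bounded by what the core keeps instead of by all of
  \<open>rel Y \<inter> ES j\<close>.\<close>

lemma matroid_bad_sampled_le:
  assumes j: "j \<in> J" and mat: "matroid (ES j) (IS j)"
  shows "sum w {e \<in> bad j Y. fst e \<in> Y} \<le> sum w (PCore w (ES j) (IS j) (rel Y \<inter> ES j))"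
proof -
  let ?P = "PCore w (ES j) (IS j) (rel Y \<inter> ES j)"
  have "sum w {e \<in> bad j Y. fst e \<in> Y} \<le> 1 * sum w ?P"
  proof (rule sum_le_of_threshold_cards)
    have "?P \<subseteq> rel Y \<inter> ES j" by (rule PCore_subset)
    then have sub: "{e \<in> bad j Y. fst e \<in> Y} \<subseteq> E" "?P \<subseteq> E"
      using bad_subset rel_subset by blast+
    then show "finite {e \<in> bad j Y. fst e \<in> Y}" "finite ?P"
      using finite_subset_E by blast+
    show "inj_on w ({e \<in> bad j Y. fst e \<in> Y} \<union> ?P)"
      by (rule inj_on_subset[OF inj_w]) (rule Un_least[OF sub])
    show "0 \<le> w e" if "e \<in> {e \<in> bad j Y. fst e \<in> Y} \<union> ?P" for e
      using that sub nonneg[of e] by blast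
    fix t
    have "basis_of (IS j) {e \<in> rel Y \<inter> ES j. t \<le> w e} {e \<in> ?P. t \<le> w e}"
      using matroid_PCore_basis[OF mat inj_on_subset[OF inj_w ES_subset[OF j]]
          bad_sampled_threshold(4)[OF j]] unfolding PCore_above .
    then show "real (card {e \<in> {e \<in> bad j Y. fst e \<in> Y}. t \<le> w e}) \<le> 1 * real (card {e \<in> ?P. t \<le> w e})"
      using matroid_card_PHull[OF mat bad_sampled_threshold(4)[OF j] _
          bad_sampled_threshold(1,3)[OF j]] by simp
  qed
  then show ?thesis by simp
qed

lemma core_rel_ge:
  "sum w (core (rel Y)) \<ge> sum w (rel Y) - (\<Sum>j\<in>J. sum w {e \<in> bad j Y. fst e \<notin> Y})"
proof -
  let ?B = "\<lambda>j. {e \<in> bad j Y. fst e \<notin> Y}"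
  have "core (rel Y) \<subseteq> rel Y"
  proof -
    \<comment> \<open>An empty intersection would be the whole type, so some component is
      needed.\<close>
    obtain j where "j \<in> J" using J_nonempty by blast
    then have "core (rel Y) \<subseteq> (rel Y - ES j) \<union> PCore w (ES j) (IS j) (rel Y \<inter> ES j)"
      unfolding core_def by blast
    also have "\<dots> \<subseteq> rel Y" using PCore_subset[of w "ES j" "IS j" "rel Y \<inter> ES j"] by auto
    finally show ?thesis .
  qed
  moreover have "rel Y \<subseteq> core (rel Y) \<union> (\<Union>j\<in>J. ?B j)"
    unfolding bad_rel core_def by auto
  ultimately have "sum w (rel Y) \<le> sum w (core (rel Y)) + (\<Sum>j\<in>J. sum w (?B j))"
    using rel_subset bad_subset nonneg
    by (intro sum_le_cover[OF finite_E finite_J]) blast+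
  then show ?thesis by simp
qed

section \<open>Expected weights and the two lower bounds\<close>

lemma
  assumes p: "0 \<le> p" "p \<le> 1"
  defines "\<E> \<equiv> measure_pmf.expectation (random_subset p A)"
  shows expectation_rel: "p * \<E> (\<lambda>Y. sum w (rel Y)) = (1 - p) * \<E> (\<lambda>Y. sum w (sample_greedy Y))"
    and expectation_bad: "p * \<E> (\<lambda>Y. sum w {e \<in> bad j Y. fst e \<notin> Y}) =
      (1 - p) * \<E> (\<lambda>Y. sum w {e \<in> bad j Y. fst e \<in> Y})"
  unfolding \<E>_def Rel_eq sample_greedy_eq
  by (rule expectation_edge_exchange[OF p candidates_subset candidates_toggle]
           expectation_edge_exchange[OF p bad_subset bad_toggle]; assumption)+

lemma expectation_sampled:
  assumes p: "0 \<le> p" "p \<le> 1" and "O' \<subseteq> E"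
  shows "measure_pmf.expectation (random_subset p A) (\<lambda>Y. sum w {e \<in> O'. fst e \<in> Y}) = p * sum w O'"
proof -
  have "finite O'" using assms(3) by (rule finite_subset_E)
  then have "sum w {e \<in> O'. fst e \<in> Y} = (\<Sum>e\<in>O'. w e * of_bool (fst e \<in> Y))" for Y
    by (auto intro!: sum.mono_neutral_cong_left)
  moreover have "measure_pmf.expectation (random_subset p A) (\<lambda>Y. of_bool (fst e \<in> Y)) = p"
    if "e \<in> O'" for e
    using that assms(3) fst_E by (intro prob_random_subset finite_A p) blast
  ultimately show ?thesis
    using integrable_random_subset[OF finite_A]
    by (simp add: Bochner_Integration.integral_sum sum_distrib_left mult.commute)
qed

text \<open>Greedy covers the sampled part of \<open>O'\<close>, of expected weight
  \<open>p * sum w O'\<close>, up to the factor \<open>k\<close>. The exchange moves the estimate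
  from the greedy set to \<open>rel Y\<close>, and \<open>p > 0\<close> cancels.\<close>

lemma expectation_rel_ge:
  assumes p: "0 < p" "p \<le> 1" and "O' \<in> \<I>"
  shows "(1 - p) * sum w O' \<le> k * measure_pmf.expectation (random_subset p A) (\<lambda>Y. sum w (rel Y))"
proof -
  let ?E = "measure_pmf.expectation (random_subset p A)"
  have int: "integrable (random_subset p A) F" for F :: "'a set \<Rightarrow> real"
    by (rule integrable_random_subset[OF finite_A])
  have "p * sum w O' = ?E (\<lambda>Y. sum w {e \<in> O'. fst e \<in> Y})"
    using p assms(3) indep_iff by (intro expectation_sampled[symmetric]) auto
  also have "\<dots> \<le> ?E (\<lambda>Y. k * sum w (sample_greedy Y))"
    using greedy_approximation[OF assms(3)] by (intro integral_mono int)
  also have "\<dots> = k * ?E (\<lambda>Y. sum w (sample_greedy Y))" by simp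
  finally have "(1 - p) * (p * sum w O') \<le> (1 - p) * (k * ?E (\<lambda>Y. sum w (sample_greedy Y)))"
    using p by (intro mult_left_mono) auto
  also have "\<dots> = p * (k * ?E (\<lambda>Y. sum w (rel Y)))"
    using arg_cong[OF expectation_rel, of p "\<lambda>x. k * x"] p by (simp only: mult.left_commute less_imp_le)
  finally have "p * ((1 - p) * sum w O') \<le> p * (k * ?E (\<lambda>Y. sum w (rel Y)))"
    by (simp add: mult.left_commute)
  then show ?thesis using p by simp
qed

lemma expectation_core_ge:
  "measure_pmf.expectation (random_subset p A) (\<lambda>Y. sum w (core (rel Y))) \<ge>
    measure_pmf.expectation (random_subset p A) (\<lambda>Y. sum w (rel Y)) -
    (\<Sum>j\<in>J. measure_pmf.expectation (random_subset p A) (\<lambda>Y. sum w {e \<in> bad j Y. fst e \<notin> Y}))"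
proof -
  note int = integrable_random_subset[OF finite_A]
  have "measure_pmf.expectation (random_subset p A)
      (\<lambda>Y. sum w (rel Y) - (\<Sum>j\<in>J. sum w {e \<in> bad j Y. fst e \<notin> Y})) \<le>
    measure_pmf.expectation (random_subset p A) (\<lambda>Y. sum w (core (rel Y)))"
    using core_rel_ge by (intro integral_mono int)
  then show ?thesis
    using int by (simp add: Bochner_Integration.integral_sum Bochner_Integration.integral_diff)
qed

lemma expectation_components_le:
  "(\<Sum>j\<in>J. g j * measure_pmf.expectation (random_subset p A) (\<lambda>Y. sum w (rel Y \<inter> ES j))) \<le>
    k * measure_pmf.expectation (random_subset p A) (\<lambda>Y. sum w (rel Y))"
proof -
  note int = integrable_random_subset[OF finite_A]
  have "measure_pmf.expectation (random_subset p A) (\<lambda>Y. \<Sum>j\<in>J. g j * sum w (rel Y \<inter> ES j)) \<le>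
      measure_pmf.expectation (random_subset p A) (\<lambda>Y. k * sum w (rel Y))"
    using sum_components_le[OF rel_subset] rel_subset nonneg
    by (intro integral_mono int) blast
  then show ?thesis using int by (simp add: Bochner_Integration.integral_sum)
qed

text \<open>Exchanging unsampled for sampled bad edges and summing over components bounds
  \<open>p\<close> times the expected loss by \<open>(1 - p) * k\<close> times the expected weight
  of \<open>rel Y\<close>. What remains is combined with \<open>expectation_rel_ge\<close>.\<close>

lemma growth_core_bound:
  fixes p :: real
  assumes p: "0 < p" "p \<le> 1" "(1 - p) * k \<le> p" and "O' \<in> \<I>"
  shows "(p - (1 - p) * k) * (1 - p) * sum w O' \<le>
    p * k * measure_pmf.expectation (random_subset p A) (\<lambda>Y. sum w (core (rel Y)))"
proof -
  let ?E = "measure_pmf.expectation (random_subset p A)"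
  have int: "integrable (random_subset p A) F" for F :: "'a set \<Rightarrow> real"
    by (rule integrable_random_subset[OF finite_A])
  have bad: "p * ?E (\<lambda>Y. sum w {e \<in> bad j Y. fst e \<notin> Y}) \<le>
      (1 - p) * (g j * ?E (\<lambda>Y. sum w (rel Y \<inter> ES j)))" if "j \<in> J" for j
  proof -
    have "?E (\<lambda>Y. sum w {e \<in> bad j Y. fst e \<in> Y}) \<le> ?E (\<lambda>Y. g j * sum w (rel Y \<inter> ES j))"
      using bad_sampled_le[OF that] by (intro integral_mono int)
    then have "(1 - p) * ?E (\<lambda>Y. sum w {e \<in> bad j Y. fst e \<in> Y}) \<le>
        (1 - p) * ?E (\<lambda>Y. g j * sum w (rel Y \<inter> ES j))"
      using p by (intro mult_left_mono) auto
    then show ?thesis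
      unfolding expectation_bad[OF less_imp_le[OF p(1)] p(2)] by simp
  qed
  have "p * (\<Sum>j\<in>J. ?E (\<lambda>Y. sum w {e \<in> bad j Y. fst e \<notin> Y})) \<le>
      (1 - p) * (\<Sum>j\<in>J. g j * ?E (\<lambda>Y. sum w (rel Y \<inter> ES j)))"
    unfolding sum_distrib_left by (intro sum_mono bad)
  also have "\<dots> \<le> (1 - p) * (k * ?E (\<lambda>Y. sum w (rel Y)))"
    using expectation_components_le p by (intro mult_left_mono) auto
  finally have loss: "p * (\<Sum>j\<in>J. ?E (\<lambda>Y. sum w {e \<in> bad j Y. fst e \<notin> Y})) \<le>
      (1 - p) * k * ?E (\<lambda>Y. sum w (rel Y))" by (simp add: mult.assoc)
  \<comment> \<open>The hypothesis \<open>(1 - p) * k \<le> p\<close> makes the factor nonnegative,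
    so the lower bound for \<open>rel Y\<close> may be inserted.\<close>
  have "(p - (1 - p) * k) * (1 - p) * sum w O' \<le> (p - (1 - p) * k) * (k * ?E (\<lambda>Y. sum w (rel Y)))"
    using expectation_rel_ge[OF p(1,2) assms(4)] p(3)
    unfolding mult.assoc by (intro mult_left_mono) auto
  also have "\<dots> = k * (p * ?E (\<lambda>Y. sum w (rel Y)) - (1 - p) * k * ?E (\<lambda>Y. sum w (rel Y)))"
    by (simp add: algebra_simps)
  also have "\<dots> \<le> k * (p * (?E (\<lambda>Y. sum w (rel Y)) -
      (\<Sum>j\<in>J. ?E (\<lambda>Y. sum w {e \<in> bad j Y. fst e \<notin> Y}))))"
    using loss by (intro mult_left_mono) (auto simp: right_diff_distrib)
  also have "\<dots> \<le> k * (p * ?E (\<lambda>Y. sum w (core (rel Y))))"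
    using expectation_core_ge p by (intro mult_left_mono) auto
  finally show ?thesis by (simp add: mult_ac)
qed

text \<open>The sampled bad edges now weigh at most \<open>rel Y \<inter> ES j\<close> minus the
  loss itself. Solving for the loss saves the factor \<open>1 / p\<close> of the growth
  bound.\<close>

lemma matroid_core_bound:
  fixes p :: real
  assumes p: "0 < p" "p \<le> 1" "(1 - p) * k \<le> 1" and "O' \<in> \<I>"
    and mat: "\<And>j. j \<in> J \<Longrightarrow> matroid (ES j) (IS j)" and g: "\<And>j. j \<in> J \<Longrightarrow> g j = 1"
  shows "(1 - (1 - p) * k) * (1 - p) * sum w O' \<le>
    k * measure_pmf.expectation (random_subset p A) (\<lambda>Y. sum w (core (rel Y)))"
proof -
  let ?E = "measure_pmf.expectation (random_subset p A)"
  have int: "integrable (random_subset p A) F" for F :: "'a set \<Rightarrow> real"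
    by (rule integrable_random_subset[OF finite_A])
  have bad: "?E (\<lambda>Y. sum w {e \<in> bad j Y. fst e \<notin> Y}) \<le>
      (1 - p) * (g j * ?E (\<lambda>Y. sum w (rel Y \<inter> ES j)))" if j: "j \<in> J" for j
  proof -
    have "sum w (PCore w (ES j) (IS j) (rel Y \<inter> ES j)) =
        sum w (rel Y \<inter> ES j) - sum w {e \<in> bad j Y. fst e \<notin> Y}" for Y
    proof -
      have "finite (rel Y \<inter> ES j)" using rel_subset finite_subset_E by blast
      then show ?thesis unfolding bad_rel by (simp add: sum_diff[OF _ PCore_subset])
    qed
    then have "?E (\<lambda>Y. sum w {e \<in> bad j Y. fst e \<in> Y}) \<le>
        ?E (\<lambda>Y. sum w (rel Y \<inter> ES j) - sum w {e \<in> bad j Y. fst e \<notin> Y})"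
      using matroid_bad_sampled_le[OF j mat[OF j]] by (intro integral_mono int) simp
    then have "?E (\<lambda>Y. sum w {e \<in> bad j Y. fst e \<in> Y}) \<le>
        ?E (\<lambda>Y. sum w (rel Y \<inter> ES j)) - ?E (\<lambda>Y. sum w {e \<in> bad j Y. fst e \<notin> Y})"
      using int by simp
    then have "p * ?E (\<lambda>Y. sum w {e \<in> bad j Y. fst e \<notin> Y}) \<le>
        (1 - p) * (?E (\<lambda>Y. sum w (rel Y \<inter> ES j)) - ?E (\<lambda>Y. sum w {e \<in> bad j Y. fst e \<notin> Y}))"
      unfolding expectation_bad[OF less_imp_le[OF p(1)] p(2)] using p
      by (intro mult_left_mono) auto
    \<comment> \<open>Collecting the loss on the left gives it the coefficient
      \<open>p + (1 - p) = 1\<close>.\<close>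
    then show ?thesis using g[OF j] by (simp add: algebra_simps)
  qed
  have "(\<Sum>j\<in>J. ?E (\<lambda>Y. sum w {e \<in> bad j Y. fst e \<notin> Y})) \<le>
      (1 - p) * (\<Sum>j\<in>J. g j * ?E (\<lambda>Y. sum w (rel Y \<inter> ES j)))"
    unfolding sum_distrib_left by (intro sum_mono bad)
  also have "\<dots> \<le> (1 - p) * (k * ?E (\<lambda>Y. sum w (rel Y)))"
    using expectation_components_le p by (intro mult_left_mono) auto
  finally have loss: "(\<Sum>j\<in>J. ?E (\<lambda>Y. sum w {e \<in> bad j Y. fst e \<notin> Y})) \<le>
      (1 - p) * k * ?E (\<lambda>Y. sum w (rel Y))" by (simp add: mult.assoc)
  have "(1 - (1 - p) * k) * (1 - p) * sum w O' \<le> (1 - (1 - p) * k) * (k * ?E (\<lambda>Y. sum w (rel Y)))"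
    using expectation_rel_ge[OF p(1,2) assms(4)] p(3)
    unfolding mult.assoc by (intro mult_left_mono) auto
  also have "\<dots> = k * (?E (\<lambda>Y. sum w (rel Y)) - (1 - p) * k * ?E (\<lambda>Y. sum w (rel Y)))"
    by (simp add: algebra_simps)
  also have "\<dots> \<le> k * ?E (\<lambda>Y. sum w (core (rel Y)))"
    using loss expectation_core_ge[of p] by (intro mult_left_mono) auto
  finally show ?thesis .
qed

end

section \<open>Agents and items\<close>

text \<open>This \<open>p\<close> maximises
  \<open>(p - (1 - p) * \<kappa>) * (1 - p) / (p * \<kappa>)\<close>, the factor of the growth
  bound. From \<open>p\<^sup>2 = \<kappa> / (\<kappa> + 1)\<close> follows
  \<open>sqrt (1 + 1 / \<kappa>) = 1 / p\<close>, and both sides of the identity become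
  \<open>2 * p * \<kappa> + p - 2 * \<kappa>\<close>.\<close>

lemma growth_ratio:
  fixes \<kappa> :: real
  assumes "1 \<le> \<kappa>"
  defines "p \<equiv> sqrt (1 - 1 / (\<kappa> + 1))"
  shows "0 < p" "p \<le> 1" "(1 - p) * \<kappa> \<le> p"
    "(p - (1 - p) * \<kappa>) * (1 - p) = p * \<kappa> * (2 + 1 / \<kappa> - 2 * sqrt (1 + 1 / \<kappa>))"
proof -
  have eq: "1 - 1 / (\<kappa> + 1) = \<kappa> / (\<kappa> + 1)" using assms(1) by (simp add: field_simps)
  have p2: "p\<^sup>2 = \<kappa> / (\<kappa> + 1)" unfolding p_def eq using assms(1) by simp
  show p0: "0 < p" unfolding p_def eq using assms(1) by simp
  show p1: "p \<le> 1" unfolding p_def using assms(1) by simp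
  have "p\<^sup>2 \<le> p" using p0 p1 by (simp add: power2_eq_square mult_left_le)
  then have "\<kappa> \<le> p * (\<kappa> + 1)" unfolding p2 using assms(1) by (simp add: field_simps)
  then show "(1 - p) * \<kappa> \<le> p" by (simp add: algebra_simps)
  have "1 + 1 / \<kappa> = (\<kappa> + 1) / \<kappa>" using assms(1) by (simp add: field_simps)
  then have "sqrt (1 + 1 / \<kappa>) = 1 / p"
    unfolding p_def eq by (simp add: real_sqrt_divide)
  then have "p * \<kappa> * (2 + 1 / \<kappa> - 2 * sqrt (1 + 1 / \<kappa>)) = 2 * p * \<kappa> + p - 2 * \<kappa>"
    using assms(1) p0 by (simp add: field_simps)
  moreover have "p\<^sup>2 * (\<kappa> + 1) = \<kappa>" unfolding p2 using assms(1) by simp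
  ultimately show "(p - (1 - p) * \<kappa>) * (1 - p) = p * \<kappa> * (2 + 1 / \<kappa> - 2 * sqrt (1 + 1 / \<kappa>))"
    by (simp add: algebra_simps power2_eq_square)
qed

lemma growth_ratio_gt:
  fixes \<kappa> :: real
  assumes "1 \<le> \<kappa>"
  shows "2 + 1 / \<kappa> - 2 * sqrt (1 + 1 / \<kappa>) > 1 / (4 * \<kappa> ^ 2) - 1 / (8 * \<kappa> ^ 3)"
proof -
  define x where "x = 1 / \<kappa>"
  have x: "0 < x" "x \<le> 1" using assms unfolding x_def by auto
  \<comment> \<open>The third-order Taylor polynomial of \<open>sqrt (1 + x)\<close> at 0; comparing
    squares shows that it overestimates the root.\<close>
  let ?t = "1 + x / 2 - x ^ 2 / 8 + x ^ 3 / 16"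
  have "?t ^ 2 - (1 + x) = x ^ 4 * (20 - 4 * x + x ^ 2) / 256"
    by (simp add: power2_eq_square power3_eq_cube power4_eq_xxxx field_simps)
  moreover have "0 < x ^ 4 * (20 - 4 * x + x ^ 2)"
    using x by (intro mult_pos_pos add_pos_nonneg) auto
  ultimately have "1 + x < ?t ^ 2" by simp
  moreover have "x ^ 2 \<le> 1" using x by (simp add: power_le_one)
  then have "0 \<le> ?t" using x zero_le_power[of x 3] by linarith
  ultimately have "sqrt (1 + x) < ?t" by (intro real_less_lsqrt) auto
  then have "2 + x - 2 * sqrt (1 + x) > x ^ 2 / 4 - x ^ 3 / 8" by linarith
  then show ?thesis unfolding x_def by (simp add: power_divide)
qed

theorem theorem6:
  fixes A :: "'a set" and B :: "'b set" and E :: "('a \<times> 'b) set"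
    and w :: "'a \<times> 'b \<Rightarrow> real"
    and M\<^sub>A M\<^sub>B :: nat
    and A' :: "nat \<Rightarrow> 'a set" and \<J> :: "nat \<Rightarrow> 'a set set"
    and B' :: "nat \<Rightarrow> 'b set" and \<L> :: "nat \<Rightarrow> 'b set set"
    and E\<^sub>A E\<^sub>B :: "nat \<Rightarrow> ('a \<times> 'b) set"
    and \<I>\<^sub>A \<I>\<^sub>B :: "nat \<Rightarrow> ('a \<times> 'b) set set"
    and \<I> :: "('a \<times> 'b) set set"
    and k\<^sub>A l\<^sub>B :: "nat \<Rightarrow> nat" and k :: nat
    and Core :: "('a \<times> 'b) set \<Rightarrow> ('a \<times> 'b) set"
    and OPT :: "('a \<times> 'b) set"
    and value_at :: "real \<Rightarrow> real"
  assumes graph: "finite A" "finite B" "E \<subseteq> A \<times> B" "E \<noteq> {}"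
    and weights: "inj_on w E" "\<And>e. e \<in> E \<Longrightarrow> 0 \<le> w e"
    and agent_systems: "\<And>j. j \<in> {1..M\<^sub>A} \<Longrightarrow> indep_system (A' j) (\<J> j)"
      "A = (\<Union>j\<in>{1..M\<^sub>A}. A' j)"
    and item_systems: "\<And>j. j \<in> {1..M\<^sub>B} \<Longrightarrow> indep_system (B' j) (\<L> j)"
      "B = (\<Union>j\<in>{1..M\<^sub>B}. B' j)"
    and agent_edges: "\<And>j. E\<^sub>A j = incident_edges fst E (A' j)"
      "\<And>j. \<I>\<^sub>A j = edge_indep fst E (A' j) (\<J> j)"
    and item_edges: "\<And>j. E\<^sub>B j = incident_edges snd E (B' j)"
      "\<And>j. \<I>\<^sub>B j = edge_indep snd E (B' j) (\<L> j)"
    and agent_growth: "\<And>j. j \<in> {1..M\<^sub>A} \<Longrightarrow> growth_system (k\<^sub>A j) (E\<^sub>A j) (\<I>\<^sub>A j)"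
    and item_growth: "\<And>j. j \<in> {1..M\<^sub>B} \<Longrightarrow> growth_system (l\<^sub>B j) (E\<^sub>B j) (\<I>\<^sub>B j)"
    and indep: "\<I> = combination {1..M\<^sub>A} E\<^sub>A \<I>\<^sub>A \<inter> combination {1..M\<^sub>B} E\<^sub>B \<I>\<^sub>B"
    and core: "\<And>X. Core X =
      (\<Inter>j\<in>{1..M\<^sub>A}. (X - E\<^sub>A j) \<union> PCore w (E\<^sub>A j) (\<I>\<^sub>A j) (X \<inter> E\<^sub>A j)) \<inter>
      (\<Inter>j\<in>{1..M\<^sub>B}. (X - E\<^sub>B j) \<union> PCore w (E\<^sub>B j) (\<I>\<^sub>B j) (X \<inter> E\<^sub>B j))"
    and k: "k = Max ((\<lambda>e. (\<Sum>j | j \<in> {1..M\<^sub>A} \<and> e \<in> E\<^sub>A j. k\<^sub>A j) +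
                           (\<Sum>j | j \<in> {1..M\<^sub>B} \<and> e \<in> E\<^sub>B j. l\<^sub>B j)) ` E)"
    and value_at: "\<And>p. value_at p = measure_pmf.expectation (random_subset p A)
                                       (\<lambda>Y. sum w (Core (Rel A E w \<I> Y)))"
    and opt: "is_arg_max (sum w) (\<lambda>X. X \<in> \<I>) OPT"
  shows "value_at (sqrt (1 - 1 / (real k + 1)))
           \<ge> (2 + 1 / real k - 2 * sqrt (1 + 1 / real k)) * sum w OPT \<and>
         2 + 1 / real k - 2 * sqrt (1 + 1 / real k)
           > 1 / (4 * real k ^ 2) - 1 / (8 * real k ^ 3) \<and>
         ((\<forall>j\<in>{1..M\<^sub>A}. matroid (E\<^sub>A j) (\<I>\<^sub>A j) \<and> k\<^sub>A j = 1) \<and>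
          (\<forall>j\<in>{1..M\<^sub>B}. matroid (E\<^sub>B j) (\<I>\<^sub>B j) \<and> l\<^sub>B j = 1) \<longrightarrow>
            (k = 1 \<longrightarrow> value_at 0 \<ge> sum w OPT) \<and>
            (k \<ge> 2 \<longrightarrow> value_at (1 - 1 / (2 * real k)) \<ge> 1 / (4 * real k ^ 2) * sum w OPT))"
proof -
  \<comment> \<open>The disjoint sum indexes the components of both sides, so that one
    interpretation treats them uniformly.\<close>
  let ?J = "{1..M\<^sub>A} <+> {1..M\<^sub>B}"
  let ?E = "case_sum E\<^sub>A E\<^sub>B" and ?I = "case_sum \<I>\<^sub>A \<I>\<^sub>B" and ?g = "case_sum k\<^sub>A l\<^sub>B"
  have ball_J: "(\<forall>j\<in>?J. P j) \<longleftrightarrow> (\<forall>j\<in>{1..M\<^sub>A}. P (Inl j)) \<and> (\<forall>j\<in>{1..M\<^sub>B}. P (Inr j))" for P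
    by auto
  have fin_E: "finite E" using graph finite_subset by (metis finite_cartesian_product)
  have fst_E: "fst e \<in> A" and snd_E: "snd e \<in> B" if "e \<in> E" for e
    using graph(3) that by auto
  have agent_cover: "\<exists>j\<in>{1..M\<^sub>A}. fst e \<in> A' j \<and> e \<in> E\<^sub>A j" if "e \<in> E" for e
    using fst_E[OF that] agent_systems(2) that unfolding agent_edges(1) incident_edges_def by auto
  have item_cover: "\<exists>j\<in>{1..M\<^sub>B}. e \<in> E\<^sub>B j" if "e \<in> E" for e
    using snd_E[OF that] item_systems(2) that unfolding item_edges(1) incident_edges_def by auto
  have sub_A: "E\<^sub>A j \<subseteq> E" for j unfolding agent_edges(1) incident_edges_def by auto
  have sub_B: "E\<^sub>B j \<subseteq> E" for j unfolding item_edges(1) incident_edges_def by auto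
  have "(\<Union>j\<in>{1..M\<^sub>A}. E\<^sub>A j) = E" using agent_cover sub_A by blast
  moreover have "(\<Union>j\<in>{1..M\<^sub>B}. E\<^sub>B j) = E" using item_cover sub_B by blast
  ultimately have indep_iff: "X \<in> \<I> \<longleftrightarrow> X \<subseteq> E \<and> (\<forall>j\<in>?J. X \<inter> ?E j \<in> ?I j)" for X
    unfolding indep combination_def ball_J by auto
  have growth: "growth_system (?g j) (?E j) (?I j)" if "j \<in> ?J" for j
    using that agent_growth item_growth by auto
  have system: "indep_system (?E j) (?I j)" if "j \<in> ?J" for j
    using growth[OF that] unfolding growth_system_def by blast
  define K where "K e = (\<Sum>j | j \<in> {1..M\<^sub>A} \<and> e \<in> E\<^sub>A j. k\<^sub>A j) + (\<Sum>j | j \<in> {1..M\<^sub>B} \<and> e \<in> E\<^sub>B j. l\<^sub>B j)" for e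
  have K_le: "K e \<le> k" if "e \<in> E" for e
    unfolding k K_def[symmetric] using fin_E that by (intro Max_ge) auto
  have k2: "2 \<le> k"
  proof -
    obtain e where e: "e \<in> E" using graph(4) by blast
    obtain i where i: "i \<in> {1..M\<^sub>A}" "e \<in> E\<^sub>A i" using agent_cover[OF e] by blast
    obtain j where j: "j \<in> {1..M\<^sub>B}" "e \<in> E\<^sub>B j" using item_cover[OF e] by blast
    have "1 \<le> k\<^sub>A i" "1 \<le> l\<^sub>B j"
      using agent_growth[OF i(1)] item_growth[OF j(1)] unfolding growth_system_def by auto
    moreover have "k\<^sub>A i \<le> (\<Sum>j | j \<in> {1..M\<^sub>A} \<and> e \<in> E\<^sub>A j. k\<^sub>A j)"
      using i by (intro member_le_sum) auto
    moreover have "l\<^sub>B j \<le> (\<Sum>j | j \<in> {1..M\<^sub>B} \<and> e \<in> E\<^sub>B j. l\<^sub>B j)"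
      using j by (intro member_le_sum) auto
    ultimately show ?thesis using K_le[OF e] unfolding K_def by linarith
  qed
  \<comment> \<open>Membership in \<open>E\<^sub>A j\<close> depends only on the agent, so two edges
    of one agent share a component, which allows at most one of them.\<close>
  have inj_fst: "inj_on fst X" if X: "X \<in> \<I>" for X
  proof (rule inj_onI)
    fix e f assume ef: "e \<in> X" "f \<in> X" "fst e = fst f"
    have E: "e \<in> E" "f \<in> E" using X ef indep_iff by auto
    obtain j where j: "j \<in> {1..M\<^sub>A}" "fst e \<in> A' j" "e \<in> E\<^sub>A j" using agent_cover[OF E(1)] by blast
    have "f \<in> E\<^sub>A j" using j ef E unfolding agent_edges(1) incident_edges_def by auto
    moreover have "X \<inter> E\<^sub>A j \<in> \<I>\<^sub>A j" using X j(1) unfolding indep combination_def by auto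
    then have "inj_on fst (X \<inter> E\<^sub>A j)" unfolding agent_edges(2) edge_indep_def by auto
    ultimately show "e = f" using ef j(3) by (auto dest: inj_onD)
  qed
  interpret growth_combination E w \<I> A ?J ?E ?I ?g k
  proof unfold_locales
    show "{} \<in> \<I>" using indep_iff indep_system_empty[OF system] by auto
    show "Y \<in> \<I>" if "X \<in> \<I>" "Y \<subseteq> X" for X Y
    proof -
      have "Y \<inter> ?E j \<in> ?I j" if "j \<in> ?J" for j
        using indep_system_down[OF system[OF that], of "X \<inter> ?E j" "Y \<inter> ?E j"]
          \<open>X \<in> \<I>\<close> \<open>Y \<subseteq> X\<close> that indep_iff by blast
      then show ?thesis using that indep_iff by blast
    qed
    show "?J \<noteq> {}" using graph(4) agent_cover by auto
    show "?E j \<subseteq> E" if "j \<in> ?J" for j using sub_A sub_B by (cases j) simp_all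
    fix e assume e: "e \<in> E"
    have "{j. j \<in> ?J \<and> e \<in> ?E j} = {j. j \<in> {1..M\<^sub>A} \<and> e \<in> E\<^sub>A j} <+> {j. j \<in> {1..M\<^sub>B} \<and> e \<in> E\<^sub>B j}"
      by auto
    then have "(\<Sum>j | j \<in> ?J \<and> e \<in> ?E j. ?g j) = K e"
      unfolding K_def by (simp add: sum.Plus)
    then show "(\<Sum>j | j \<in> ?J \<and> e \<in> ?E j. ?g j) \<le> k" using K_le[OF e] by simp
  qed (use fin_E weights graph fst_E inj_fst growth indep_iff k2 in auto)
  have "Core X = core X" for X
    by (simp only: core core_def set_eq_iff Int_iff INT_iff ball_J sum.case simp_thms)
  then have value_eq: "value_at p = measure_pmf.expectation (random_subset p A) (\<lambda>Y. sum w (core (rel Y)))"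
    for p unfolding value_at by simp
  have OPT: "OPT \<in> \<I>" using opt unfolding is_arg_max_def by auto
  have k_real: "1 \<le> real k" using k2 by simp
  note ratio = growth_ratio[OF k_real]
  let ?p = "sqrt (1 - 1 / (real k + 1))" and ?c = "2 + 1 / real k - 2 * sqrt (1 + 1 / real k)"
  have "?p * real k * (?c * sum w OPT) \<le> ?p * real k * value_at ?p"
    using growth_core_bound[OF ratio(1-3) OPT] unfolding ratio(4) value_eq by (simp only: mult.assoc)
  then have general: "?c * sum w OPT \<le> value_at ?p"
    using ratio(1) k_real by (subst (asm) mult_le_cancel_left_pos) auto
  have "1 / (4 * real k ^ 2) * sum w OPT \<le> value_at (1 - 1 / (2 * real k))"
    if "(\<forall>j\<in>{1..M\<^sub>A}. matroid (E\<^sub>A j) (\<I>\<^sub>A j) \<and> k\<^sub>A j = 1) \<and>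
      (\<forall>j\<in>{1..M\<^sub>B}. matroid (E\<^sub>B j) (\<I>\<^sub>B j) \<and> l\<^sub>B j = 1)"
  proof -
    \<comment> \<open>With \<open>x = (1 - p) * k\<close> the matroid factor is
      \<open>(1 - x) * x / k\<^sup>2\<close>, which is largest at \<open>x = 1 / 2\<close>.\<close>
    let ?p = "1 - 1 / (2 * real k)"
    have half: "(1 - ?p) * real k = 1 / 2" using k_real by simp
    have "0 < ?p" "?p \<le> 1" using k_real by (auto simp: field_simps)
    moreover have "(1 - ?p) * real k \<le> 1" using half by simp
    ultimately have "(1 - (1 - ?p) * real k) * (1 - ?p) * sum w OPT \<le> real k * value_at ?p"
      unfolding value_eq by (rule matroid_core_bound[OF _ _ _ OPT]) (use that in auto)
    then have "real k * (1 / (4 * real k ^ 2) * sum w OPT) \<le> real k * value_at ?p"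
      unfolding half using k_real by (simp add: power2_eq_square)
    then show ?thesis using k_real by (subst (asm) mult_le_cancel_left_pos) auto
  qed
  then show ?thesis
    using general growth_ratio_gt[OF k_real] k2 by auto
qed

end
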